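(* Fix an integer $g\geq 3$. For $a\in[0,1)$ and $b\in[1,e)$ define $h(a,b)=\frac{(1-a)\ln b}{b}$ and \[ f_g(a,b)=\exp\left(\frac{(1-a)\ln b}{b}\right)-1+\frac{b(\ln b)^{g-1}}{2(1-\ln b)}. \] Let $a\in[0,1)$ and $b\in[1,e)$ satisfy $f_g(a,b)\leq a$. Then for any graph $G$ of girth at least $g$ and maximum degree at most $\Delta\geq 1$, and any $x\in\mathbb{C}$ with $|x|\leq h(a,b)/\Delta$, we have $F_G(x)\neq 0$; consequently $\chi_G(x)\neq 0$ for any $x\in\mathbb{C}$ with $|x|\geq \Delta/h(a,b)$.
   Context: Let $G=(V,E)$ be a finite simple graph with a fixed total ordering of $E$. A broken circuit is the edge set of a cycle of $G$ with its largest edge removed; an edge set $F\subseteq E$ is broken-circuit-free (BCF) if it contains no broken circuit. $F_G(x)=\sum_{F} x^{|F|}$, summed over all BCF edge sets $F$ (including $\emptyset$); this polynomial does not depend on the chosen ordering. The chromatic polynomial is $\chi_G(x)=\sum_{A\subseteq E}(-1)^{|A|}x^{\kappa(A)}$ with $\kappa(A)$ the number of components of $(V,A)$. The girth of $G$ is the length of a shortest cycle (infinite if acyclic). *)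

theory Defs
  imports Complex_Main "HOL-Library.Extended_Nat" "HOL-Computational_Algebra.Polynomial"
begin

definition simple_graph :: "'a set \<Rightarrow> 'a set set \<Rightarrow> bool" where
  "simple_graph V E \<longleftrightarrow> finite V \<and> (\<forall>e\<in>E. e \<subseteq> V \<and> card e = 2)"

text \<open>A cycle is given by the cyclic list of its pairwise distinct vertices; its length is the
  length of the list, which is also the number of its edges.\<close>

definition cycle_edges :: "'a list \<Rightarrow> 'a set set" where
  "cycle_edges vs = {{vs ! i, vs ! (Suc i mod length vs)} | i. i < length vs}"

definition is_cycle :: "'a set set \<Rightarrow> 'a list \<Rightarrow> bool" where
  "is_cycle E vs \<longleftrightarrow> length vs \<ge> 3 \<and> distinct vs \<and> cycle_edges vs \<subseteq> E"

text \<open>The infimum of the empty set in \<^typ>\<open>enat\<close> is \<open>\<infinity>\<close>, so acyclic graphs have infinite girth.\<close>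

definition girth :: "'a set set \<Rightarrow> enat" where
  "girth E = (INF vs \<in> {vs. is_cycle E vs}. enat (length vs))"

definition degree_of :: "'a set set \<Rightarrow> 'a \<Rightarrow> nat" where
  "degree_of E v = card {e \<in> E. v \<in> e}"

text \<open>The supremum of the empty set in \<^typ>\<open>nat\<close> is 0, the value for the graph without vertices.\<close>

definition max_degree :: "'a set \<Rightarrow> 'a set set \<Rightarrow> nat" where
  "max_degree V E = (SUP v \<in> V. degree_of E v)"

text \<open>The total ordering of the edges is a reflexive relation \<open>r\<close>, with \<open>(e', e) \<in> r\<close> for
  \<open>e' \<le> e\<close>.\<close>

definition broken_circuit :: "'a set rel \<Rightarrow> 'a set set \<Rightarrow> 'a set set \<Rightarrow> bool" where
  "broken_circuit r E B \<longleftrightarrow>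
     (\<exists>vs e. is_cycle E vs \<and> e \<in> cycle_edges vs \<and> (\<forall>e'\<in>cycle_edges vs. (e', e) \<in> r) \<and>
             B = cycle_edges vs - {e})"

definition BCF :: "'a set rel \<Rightarrow> 'a set set \<Rightarrow> 'a set set \<Rightarrow> bool" where
  "BCF r E F \<longleftrightarrow> F \<subseteq> E \<and> \<not> (\<exists>B. broken_circuit r E B \<and> B \<subseteq> F)"

definition BCF_poly :: "'a set rel \<Rightarrow> 'a set set \<Rightarrow> 'b::comm_ring_1 poly" where
  "BCF_poly r E = (\<Sum>F | BCF r E F. monom 1 (card F))"

definition connected_rel :: "'a set \<Rightarrow> 'a set set \<Rightarrow> 'a rel" where
  "connected_rel V A = {(u, v). u \<in> V \<and> v \<in> V \<and> (u, v) \<in> {(x, y). {x, y} \<in> A}\<^sup>*}"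

definition num_components :: "'a set \<Rightarrow> 'a set set \<Rightarrow> nat" where
  "num_components V A = card (V // connected_rel V A)"

definition chromatic_poly :: "'a set \<Rightarrow> 'a set set \<Rightarrow> 'b::comm_ring_1 poly" where
  "chromatic_poly V E = (\<Sum>A\<in>Pow E. monom ((-1) ^ card A) (num_components V A))"

definition h_fun :: "real \<Rightarrow> real \<Rightarrow> real" where
  "h_fun a b = (1 - a) * ln b / b"

definition f_fun :: "nat \<Rightarrow> real \<Rightarrow> real \<Rightarrow> real" where
  "f_fun g a b = exp ((1 - a) * ln b / b) - 1 + b * ln b ^ (g - 1) / (2 * (1 - ln b))"

end

theory Submission
  imports Defs
begin

text \<open>By Whitney's broken circuit theorem \<open>F\<^sub>G\<close> does not depend on the ordering of the edges. By
  induction on the number of edges, \<open>F\<^sub>G(x) \<noteq> 0\<close> and \<open>\<bar>F\<^sub>G(x) - F\<^bsub>G-u\<^esub>(x)\<bar> \<le> a \<bar>F\<^bsub>G-u\<^esub>(x)\<bar>\<close> for every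
  vertex \<open>u\<close>. Put the edges \<open>uv\<^sub>1, \<dots>, uv\<^sub>d\<close> back into \<open>G - u\<close> one at a time, each as the largest edge.
  Each step multiplies by \<open>1 + x\<close>, after subtracting the terms of the forests that already join \<open>u\<close> to
  \<open>v\<^sub>i\<close>. The factors \<open>(1 + x)\<^sup>d\<close> account for the term \<open>exp(h) - 1\<close> of \<open>f\<^sub>g\<close>. A subtracted forest has a
  tree component containing a path from \<open>u\<close> to \<open>v\<^sub>i\<close>, which closes up to a cycle of length at least
  \<open>g\<close>; by the induction hypothesis each edge of the tree costs at most \<open>\<bar>x\<bar> / (1 - a)\<close>, and the branches
  off each vertex of the path contribute at most \<open>b\<close>. As each cycle arises from only one of its two
  orientations, this gives the term \<open>b (ln b)\<^sup>g\<^sup>-\<^sup>1 / (2 (1 - ln b))\<close>.\<close>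

section \<open>Connectivity by edge sets\<close>

text \<open>Each reinserted edge has to be the largest one, so the ordering changes all the time.
  Hence \<open>bcf_fun\<close> is defined by a signed sum in which no ordering occurs, and Whitney's
  theorem evaluates it for whichever injective labelling is convenient. A broken circuit is treated
  as a connection by smaller edges between the ends of an edge; cycles as vertex lists enter only
  with the girth and in the final translation. \<open>G - u\<close> is \<open>avoid E {u}\<close> on
  the same vertex set: an isolated vertex leaves the polynomial unchanged, so the induction concerns
  edge sets only. The bound \<open>h_fun\<close> is made for trees. Let
  \<open>c = norm x / (1 - a)\<close> be the price of a tree edge. Then
  \<open>norm x * \<Delta> \<le> h_fun a b\<close> says \<open>c * b * \<Delta> \<le> ln b\<close>,
  hence \<open>(1 + c * b) ^ \<Delta> \<le> b\<close>: if the trees beyond each edge at a vertex sum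
  to at most \<open>b\<close>, so do the trees at the vertex itself.\<close>

definition conn :: "'a set set \<Rightarrow> 'a \<Rightarrow> 'a \<Rightarrow> bool" where
  "conn A u v \<longleftrightarrow> (u, v) \<in> {(x, y). {x, y} \<in> A}\<^sup>*"

lemma conn_refl [simp]: "conn A u u"
  by (simp add: conn_def)

lemma conn_trans: "conn A u v \<Longrightarrow> conn A v w \<Longrightarrow> conn A u w"
  by (auto simp: conn_def)

lemma conn_edge: "{u, v} \<in> A \<Longrightarrow> conn A u v"
  by (auto simp: conn_def)

lemma conn_sym: "conn A u v \<Longrightarrow> conn A v u"
proof -
  have "sym {(x, y). {x, y} \<in> A}"
    by (auto simp: sym_def insert_commute)
  then show "conn A u v \<Longrightarrow> conn A v u"
    unfolding conn_def by (meson sym_rtrancl symD)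
qed

lemma conn_mono: "conn A u v \<Longrightarrow> A \<subseteq> B \<Longrightarrow> conn B u v"
  unfolding conn_def by (rule rtrancl_mono[THEN subsetD]) auto

lemma conn_induct [consumes 1, case_names refl step]:
  assumes "conn A u v" and "P u"
    and "\<And>y z. conn A u y \<Longrightarrow> {y, z} \<in> A \<Longrightarrow> P y \<Longrightarrow> P z"
  shows "P v"
  using assms(1) unfolding conn_def
  by (induction rule: rtrancl_induct) (use assms in \<open>auto simp: conn_def\<close>)

lemma conn_converse_induct [consumes 1, case_names refl step]:
  assumes "conn A u v" and "P v"
    and "\<And>y z. {y, z} \<in> A \<Longrightarrow> conn A z v \<Longrightarrow> P z \<Longrightarrow> P y"
  shows "P u"
  using assms(1) unfolding conn_def
  by (induction rule: converse_rtrancl_induct) (use assms in \<open>auto simp: conn_def\<close>)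

text \<open>A walk can be shortened until it uses the new edge at most once; the last two cases are
  the two directions of that use.\<close>

lemma conn_insertD:
  assumes "conn (insert {p, q} A) x y"
  shows "conn A x y \<or> conn A x p \<and> conn A q y \<or> conn A x q \<and> conn A p y"
  using assms
proof (induction rule: conn_induct)
  case (step y z)
  show ?case
  proof (cases "{y, z} \<in> A")
    case True
    then show ?thesis using step by (meson conn_edge conn_trans)
  next
    case False
    with step have "{y, z} = {p, q}" by auto
    then have "y = p \<and> z = q \<or> y = q \<and> z = p" by (auto simp: doubleton_eq_iff)
    then show ?thesis using step by (auto intro: conn_refl)
  qed
qed simp

lemma conn_insert_redundant:
  assumes "conn A p q"
  shows "conn (insert {p, q} A) = conn A"
proof (intro ext iffI)
  fix x y assume "conn (insert {p, q} A) x y"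
  then show "conn A x y"
    using conn_insertD[of p q A x y] assms conn_sym[OF assms] by (meson conn_trans)
qed (auto intro: conn_mono)

text \<open>Every edge lies inside \<open>C\<close> or misses it, so a walk never changes sides.
  This is what makes a component and the rest of an edge set independent of each other.\<close>

lemma conn_separated:
  assumes "conn (T \<union> B) p q"
    and "\<And>e. e \<in> T \<Longrightarrow> e \<subseteq> C" and "\<And>e. e \<in> B \<Longrightarrow> e \<inter> C = {}"
  shows "(p \<in> C \<longrightarrow> q \<in> C \<and> conn T p q) \<and> (p \<notin> C \<longrightarrow> q \<notin> C \<and> conn B p q)"
  using assms(1)
proof (induction rule: conn_induct)
  case (step y z)
  show ?case
  proof (cases "y \<in> C")
    case True
    then have "{y, z} \<in> T" using step(2) assms(3) by blast
    then show ?thesis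
      using step(3) True assms(2)[of "{y, z}"] by (auto intro: conn_trans conn_edge)
  next
    case False
    then have "{y, z} \<in> B" using step(2) assms(2) by blast
    then show ?thesis
      using step(3) False assms(3)[of "{y, z}"] by (auto intro: conn_trans conn_edge)
  qed
qed simp

text \<open>Deletion of the vertices in \<open>X\<close>; they remain in the graph as isolated
  vertices.\<close>

definition avoid :: "'a set set \<Rightarrow> 'a set \<Rightarrow> 'a set set" where
  "avoid E X = {e \<in> E. e \<inter> X = {}}"

lemma avoid_subset: "avoid E X \<subseteq> E"
  by (auto simp: avoid_def)

lemma avoid_avoid: "avoid (avoid E X) Y = avoid E (X \<union> Y)"
  by (auto simp: avoid_def)

text \<open>Cut a walk at its last visit to \<open>u\<close>: what follows the next edge avoids
  \<open>u\<close>.\<close>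

lemma conn_first_edge:
  assumes "conn T u v" and "u \<noteq> v"
  obtains w where "{u, w} \<in> T" and "conn (avoid T {u}) w v"
proof -
  have isolated: "u = v" if "conn (avoid T {u}) u v"
    using that by (induction rule: conn_induct) (auto simp: avoid_def)
  have "conn (avoid T {u}) z v \<or> (\<exists>w. {u, w} \<in> T \<and> conn (avoid T {u}) w v)" if "conn T z v" for z
    using that
  proof (induction rule: conn_converse_induct)
    case (step y z)
    show ?case
    proof (cases "u \<in> {y, z}")
      case True
      then show ?thesis using step isolated assms(2) by (metis conn_refl insertE singletonD)
    next
      case False
      then have "{y, z} \<in> avoid T {u}" using step by (auto simp: avoid_def)
      then show ?thesis using step by (meson conn_edge conn_trans)
    qed
  qed simp
  with assms isolated that show thesis by blast
qed

section \<open>Acyclic edge sets and rooted trees\<close>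

text \<open>A forest as a set of edges each of which is a bridge, the property by which trees are
  split below.\<close>

definition acyclic_edges :: "'a set set \<Rightarrow> bool" where
  "acyclic_edges F \<longleftrightarrow> (\<forall>x y. {x, y} \<in> F \<longrightarrow> \<not> conn (F - {{x, y}}) x y)"

lemma acyclic_edges_empty [simp]: "acyclic_edges {}"
  by (simp add: acyclic_edges_def)

lemma acyclic_edges_subset: "acyclic_edges F \<Longrightarrow> T \<subseteq> F \<Longrightarrow> acyclic_edges T"
  unfolding acyclic_edges_def by (meson Diff_mono conn_mono order_refl subsetD)

text \<open>If the new edge reconnected the ends of a deleted old edge \<open>{x, y}\<close>, then
  the two pieces of that detour together with \<open>{x, y}\<close> would join \<open>p\<close> to
  \<open>q\<close> inside \<open>F\<close>.\<close>

lemma acyclic_edges_insert: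
  assumes "acyclic_edges F" and "\<not> conn F p q"
  shows "acyclic_edges (insert {p, q} F)"
  unfolding acyclic_edges_def
proof (intro allI impI notI)
  fix x y
  assume xy: "{x, y} \<in> insert {p, q} F" and c: "conn (insert {p, q} F - {{x, y}}) x y"
  show False
  proof (cases "{x, y} = {p, q}")
    case True
    then have "conn F x y" using c by (auto elim: conn_mono)
    then show False using True assms(2) by (metis conn_sym doubleton_eq_iff)
  next
    case False
    then have "insert {p, q} F - {{x, y}} = insert {p, q} (F - {{x, y}})" by auto
    moreover have xyF: "{x, y} \<in> F" using xy False by auto
    ultimately have
      "conn (F - {{x, y}}) x p \<and> conn (F - {{x, y}}) q y \<or> conn (F - {{x, y}}) x q \<and> conn (F - {{x, y}}) p y"
      using c conn_insertD[of p q "F - {{x, y}}" x y] assms(1) by (auto simp: acyclic_edges_def)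
    then have "conn F x p \<and> conn F q y \<or> conn F x q \<and> conn F p y"
      by (meson Diff_subset conn_mono)
    then show False using assms(2) conn_edge[OF xyF] by (meson conn_sym conn_trans)
  qed
qed

text \<open>The subtrees that contain \<open>u\<close>, given by their edges; the empty set stands
  for the single vertex \<open>u\<close>.\<close>

definition rooted_trees :: "'a set set \<Rightarrow> 'a \<Rightarrow> 'a set set set" where
  "rooted_trees E u = {T. T \<subseteq> E \<and> acyclic_edges T \<and> (\<forall>e\<in>T. \<exists>x\<in>e. conn T u x)}"

lemma finite_rooted_trees: "finite E \<Longrightarrow> finite (rooted_trees E u)"
  by (rule finite_subset[of _ "Pow E"]) (auto simp: rooted_trees_def)

text \<open>For a tree \<open>T\<close>, the subtree that hangs from \<open>u\<close> through
  \<open>w\<close>, without the edge leading to it.\<close>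

definition branch :: "'a \<Rightarrow> 'a \<Rightarrow> 'a set set \<Rightarrow> 'a set set" where
  "branch u w T = {f \<in> T - {{u, w}}. \<exists>x\<in>f. conn (T - {{u, w}}) w x}"

text \<open>The edge \<open>{u, w}\<close> is a bridge, so its removal separates the branch at
  \<open>w\<close> from the part at \<open>u\<close>. The two host graphs are chosen for the
  recursions: the part at \<open>u\<close> sees one neighbour of \<open>u\<close> less, and the
  branch sees a graph without \<open>u\<close>.\<close>

lemma rooted_tree_split:
  assumes T: "T \<in> rooted_trees E u" and e: "{u, w} \<in> T"
    and E2: "\<And>e. e \<in> E \<Longrightarrow> card e = 2"
  shows "branch u w T \<in> rooted_trees (avoid E {u}) w" (is "?Tw \<in> _")
    and "T - {{u, w}} - branch u w T \<in> rooted_trees (E - {{u, w}}) u" (is "?Tu \<in> _")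
    and "conn (T - {{u, w}}) w v \<Longrightarrow> conn (branch u w T) w v"
    and "conn T u v \<Longrightarrow> conn (T - {{u, w}} - branch u w T) u v \<or> conn (branch u w T) w v"
proof -
  let ?A = "T - {{u, w}}"
  define C where "C = {z. conn ?A w z}"
  have TE: "T \<subseteq> E" and ac: "acyclic_edges T" and root: "\<And>e. e \<in> T \<Longrightarrow> \<exists>x\<in>e. conn T u x"
    using T by (auto simp: rooted_trees_def)
  have nuw: "\<not> conn ?A u w" using ac e by (auto simp: acyclic_edges_def)
  then have uC: "u \<notin> C" by (auto simp: C_def dest: conn_sym)
  have edge_conn: "conn ?A y z" if "f \<in> ?A" "y \<in> f" "z \<in> f" for f y z
  proof (cases "y = z")
    case False
    have "card f = 2" using that E2 TE by auto
    then have "f = {y, z}" using that False by (auto simp: card_2_iff)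
    then show ?thesis using that by (auto intro: conn_edge)
  qed auto
  have TwC: "f \<subseteq> C" if "f \<in> ?Tw" for f
    using that edge_conn by (auto simp: branch_def C_def intro: conn_trans)
  have TuC: "f \<inter> C = {}" if "f \<in> ?Tu" for f
    using that by (auto simp: branch_def C_def)
  have un: "?Tw \<union> ?Tu = ?A" by (auto simp: branch_def)
  have sepw: "conn ?Tw w z" if "conn ?A w z" for z
    using conn_separated[of ?Tw ?Tu w z C] that TwC TuC unfolding un by (auto simp: C_def)
  have sepu: "conn ?Tu u z" if "conn ?A u z" for z
    using conn_separated[of ?Tw ?Tu u z C] that TwC TuC uC unfolding un by (auto simp: C_def)
  have cases: "conn ?A u x \<or> conn ?A w x" if "conn T u x" for x
  proof -
    have "insert {u, w} ?A = T" using e by auto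
    then show ?thesis using conn_insertD[of u w ?A u x] that nuw by auto
  qed
  show "conn ?A w v \<Longrightarrow> conn ?Tw w v" by (rule sepw)
  show "conn T u v \<Longrightarrow> conn ?Tu u v \<or> conn ?Tw w v" using cases sepw sepu by blast
  have "?Tw \<subseteq> avoid E {u}"
    using TwC uC TE by (auto simp: avoid_def branch_def)
  moreover have "acyclic_edges ?Tw" by (rule acyclic_edges_subset[OF ac]) (auto simp: branch_def)
  moreover have "\<exists>x\<in>f. conn ?Tw w x" if "f \<in> ?Tw" for f
    using that sepw by (auto simp: branch_def)
  ultimately show "?Tw \<in> rooted_trees (avoid E {u}) w" by (auto simp: rooted_trees_def)
  have "acyclic_edges ?Tu" by (rule acyclic_edges_subset[OF ac]) auto
  moreover have "\<exists>x\<in>f. conn ?Tu u x" if f: "f \<in> ?Tu" for f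
  proof -
    obtain x where x: "x \<in> f" "conn T u x" using f root by blast
    have "\<not> conn ?A w x" using TuC[OF f] x by (auto simp: C_def)
    then show ?thesis using cases[OF x(2)] sepu x(1) by blast
  qed
  ultimately show "?Tu \<in> rooted_trees (E - {{u, w}}) u"
    using TE by (auto simp: rooted_trees_def)
qed

lemma rooted_trees_isolated:
  assumes "\<And>w. {u, w} \<notin> E" and "\<And>e. e \<in> E \<Longrightarrow> card e = 2"
  shows "rooted_trees E u = {{}}"
proof -
  have "T = {}" if T: "T \<in> rooted_trees E u" for T
  proof (rule ccontr)
    assume "T \<noteq> {}"
    then obtain f x where f: "f \<in> T" "x \<in> f" "conn T u x"
      using T unfolding rooted_trees_def by blast
    have TE: "T \<subseteq> E" using T by (auto simp: rooted_trees_def)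
    have "x \<noteq> u"
    proof
      assume "x = u"
      moreover have "card f = 2" using f TE assms(2) by auto
      ultimately obtain w where "f = {u, w}" using f(2) by (auto simp: card_2_iff)
      then show False using assms(1) f TE by auto
    qed
    then show False using conn_first_edge[OF f(3)] assms(1) TE by (metis subsetD)
  qed
  then show ?thesis by (auto simp: rooted_trees_def)
qed

text \<open>Bounds the vertices deleted together with a tree, each of which will cost a factor
  \<open>1 / (1 - a)\<close>, by the root and one vertex for each edge.\<close>

lemma card_rooted_tree_vertices:
  assumes "T \<in> rooted_trees E u" and "finite E" and "\<And>e. e \<in> E \<Longrightarrow> card e = 2"
  shows "finite {z. conn T u z} \<and> card {z. conn T u z} \<le> Suc (card T)"
  using assms
proof (induction "card T" arbitrary: T E u rule: less_induct)
  case less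
  have fT: "finite T"
    using less.prems by (auto simp: rooted_trees_def intro: finite_subset)
  show ?case
  proof (cases "\<exists>w. {u, w} \<in> T")
    case False
    then have "{z. conn T u z} = {u}" by (auto elim: conn_first_edge)
    then show ?thesis by simp
  next
    case True
    then obtain w where w: "{u, w} \<in> T" by blast
    let ?Tw = "branch u w T" and ?Tu = "T - {{u, w}} - branch u w T"
    note split = rooted_tree_split[OF less.prems(1) w less.prems(3)]
    have dis: "?Tw \<inter> ?Tu = {}" and un: "insert {u, w} (?Tw \<union> ?Tu) = T"
      and notin: "{u, w} \<notin> ?Tw \<union> ?Tu" and sub: "?Tw \<subseteq> T" "?Tu \<subseteq> T"
      using w by (auto simp: branch_def)
    have fin: "finite ?Tw" "finite ?Tu" using sub fT by (auto intro: finite_subset)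
    have card: "card T = Suc (card ?Tw + card ?Tu)"
      using card_insert_disjoint[of "?Tw \<union> ?Tu" "{u, w}"] notin fin card_Un_disjoint[OF fin dis]
      by (simp only: un) simp
    have "finite {z. conn ?Tw w z} \<and> card {z. conn ?Tw w z} \<le> Suc (card ?Tw)"
      by (rule less.hyps[OF _ split(1)])
        (use card less.prems in \<open>auto simp: avoid_def\<close>)
    moreover have "finite {z. conn ?Tu u z} \<and> card {z. conn ?Tu u z} \<le> Suc (card ?Tu)"
      by (rule less.hyps[OF _ split(2)]) (use card less.prems in auto)
    moreover have "{z. conn T u z} \<subseteq> {z. conn ?Tu u z} \<union> {z. conn ?Tw w z}"
      using split(4) by blast
    ultimately show ?thesis
      using card card_Un_le[of "{z. conn ?Tu u z}" "{z. conn ?Tw w z}"]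
        card_mono[of "{z. conn ?Tu u z} \<union> {z. conn ?Tw w z}" "{z. conn T u z}"]
      by (auto intro: finite_subset)
  qed
qed

section \<open>Broken-circuit-free sets via an injective edge labelling\<close>

text \<open>A cycle without its largest edge is a path of smaller edges between the ends of that
  edge, so being broken-circuit-free is a statement about connectivity. With labels in
  \<open>nat\<close>, a new edge can always be given a label above all the others.\<close>

definition bcf :: "('a set \<Rightarrow> nat) \<Rightarrow> 'a set set \<Rightarrow> 'a set set \<Rightarrow> bool" where
  "bcf \<rho> E F \<longleftrightarrow> F \<subseteq> E \<and>
     (\<forall>p q. {p, q} \<in> E \<longrightarrow> p \<noteq> q \<longrightarrow> \<not> conn {f \<in> F. \<rho> f < \<rho> {p, q}} p q)"

lemma bcf_subset: "bcf \<rho> E F \<Longrightarrow> F \<subseteq> E"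
  by (simp add: bcf_def)

lemma bcfD: "bcf \<rho> E F \<Longrightarrow> {p, q} \<in> E \<Longrightarrow> p \<noteq> q \<Longrightarrow> \<not> conn {f \<in> F. \<rho> f < \<rho> {p, q}} p q"
  by (simp add: bcf_def)

lemma bcf_mono:
  assumes "bcf \<rho> E F" and "E' \<subseteq> E" and "F' \<subseteq> F" and "F' \<subseteq> E'"
  shows "bcf \<rho> E' F'"
  unfolding bcf_def
proof (intro conjI allI impI notI)
  fix p q assume pq: "{p, q} \<in> E'" "p \<noteq> q" and c: "conn {f \<in> F'. \<rho> f < \<rho> {p, q}} p q"
  have "conn {f \<in> F. \<rho> f < \<rho> {p, q}} p q" by (rule conn_mono[OF c]) (use assms in auto)
  then show False using assms pq by (auto simp: bcf_def)
qed (fact assms)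

lemma finite_bcf: "finite E \<Longrightarrow> finite {F. bcf \<rho> E F \<and> P F}"
  by (rule finite_subset[of _ "Pow E"]) (auto simp: bcf_def)

text \<open>All other edges of \<open>F\<close> lie below the largest one, so the condition at this
  edge says that the rest of \<open>F\<close> does not join its ends. Peeling it off drives the
  inductions on broken-circuit-free sets.\<close>

lemma bcf_max_edge:
  assumes "bcf \<rho> E F" and F: "finite F" "F \<noteq> {}" and inj: "inj_on \<rho> E"
    and E2: "\<And>e. e \<in> E \<Longrightarrow> card e = 2"
  obtains p q where "{p, q} \<in> F" and "p \<noteq> q" and "bcf \<rho> E (F - {{p, q}})"
    and "\<not> conn (F - {{p, q}}) p q"
proof -
  have FE: "F \<subseteq> E" using assms bcf_subset by blast
  have "Max (\<rho> ` F) \<in> \<rho> ` F" using F by simp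
  then obtain e where e: "e \<in> F" "\<rho> e = Max (\<rho> ` F)" by force
  have less: "\<rho> f < \<rho> e" if "f \<in> F" "f \<noteq> e" for f
  proof -
    have "\<rho> f \<le> \<rho> e" using that F e by simp
    moreover have "\<rho> f \<noteq> \<rho> e" using that e FE inj_on_eq_iff[OF inj, of f e] by auto
    ultimately show ?thesis by simp
  qed
  have "card e = 2" using E2 e FE by blast
  then obtain p q where pq: "e = {p, q}" "p \<noteq> q" by (auto simp: card_2_iff)
  have "{f \<in> F. \<rho> f < \<rho> e} = F - {e}" using less by auto
  moreover have "{p, q} \<in> E" using pq(1) e(1) FE by auto
  ultimately have "\<not> conn (F - {e}) p q" using bcfD[OF assms(1) _ pq(2)] pq(1) by simp
  moreover have "bcf \<rho> E (F - {e})" by (rule bcf_mono[OF assms(1)]) (use FE in auto)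
  ultimately show thesis using that pq e by auto
qed

lemma bcf_acyclic:
  assumes "bcf \<rho> E F" and "finite F" and "inj_on \<rho> E" and "\<And>e. e \<in> E \<Longrightarrow> card e = 2"
  shows "acyclic_edges F"
  using assms(2,1)
proof (induction "card F" arbitrary: F)
  case (Suc n)
  then have "F \<noteq> {}" by auto
  then obtain p q where pq: "{p, q} \<in> F" "bcf \<rho> E (F - {{p, q}})" "\<not> conn (F - {{p, q}}) p q"
    using bcf_max_edge[OF Suc.prems(2,1) _ assms(3,4)] by metis
  then have "acyclic_edges (insert {p, q} (F - {{p, q}}))"
    using Suc by (intro acyclic_edges_insert Suc) auto
  then show ?case using pq by (simp add: insert_absorb)
qed simp

section \<open>Components and Whitney's theorem\<close>

lemma connected_rel_conn: "connected_rel V A = {(u, v). u \<in> V \<and> v \<in> V \<and> conn A u v}"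
  by (simp add: connected_rel_def conn_def)

lemma num_components_cong: "conn A = conn B \<Longrightarrow> num_components V A = num_components V B"
  by (simp add: num_components_def connected_rel_conn)

lemma num_components_le: "finite V \<Longrightarrow> num_components V A \<le> card V"
  by (simp add: num_components_def quotient_def UNION_singleton_eq_range card_image_le)

text \<open>The classes of \<open>p\<close> and \<open>q\<close> merge into one; the vertices in
  \<open>W\<close>, outside both, keep their classes.\<close>

lemma num_components_insert:
  assumes V: "finite V" "p \<in> V" "q \<in> V" and n: "\<not> conn A p q"
  shows "num_components V A = Suc (num_components V (insert {p, q} A))"
proof -
  let ?B = "insert {p, q} A"
  define cl where "cl A x = {y \<in> V. conn A x y}" for A :: "'a set set" and x
  have quot: "V // connected_rel V D = cl D ` V" for D
    by (auto simp: quotient_def connected_rel_conn cl_def Image_def)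
  have cl_eq: "cl D x = cl D y \<longleftrightarrow> conn D x y" if "x \<in> V" "y \<in> V" for x y D
  proof
    assume "cl D x = cl D y"
    moreover have "y \<in> cl D y" using that by (simp add: cl_def)
    ultimately have "y \<in> cl D x" by blast
    then show "conn D x y" by (simp add: cl_def)
  next
    assume "conn D x y"
    then have "conn D x z \<longleftrightarrow> conn D y z" for z by (meson conn_sym conn_trans)
    then show "cl D x = cl D y" by (simp add: cl_def)
  qed
  define W where "W = {x \<in> V. \<not> conn A p x \<and> \<not> conn A q x}"
  have conn_sub: "conn ?B x y" if "conn A x y" for x y
    using that by (rule conn_mono) auto
  have pq: "conn ?B p q" by (rule conn_edge) auto
  have W: "cl ?B x = cl A x" if "x \<in> W" for x
  proof -
    have "conn ?B x y \<longleftrightarrow> conn A x y" for y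
      using conn_insertD[of p q A x y] that conn_sub conn_sym[of A x p] conn_sym[of A x q]
      by (auto simp: W_def)
    then show ?thesis by (auto simp: cl_def)
  qed
  have split: "cl D ` V = insert (cl D p) (insert (cl D q) (cl D ` W))"
    if "\<And>x y. conn A x y \<Longrightarrow> conn D x y" for D
  proof -
    have "cl D x \<in> insert (cl D p) (insert (cl D q) (cl D ` W))" if x: "x \<in> V" for x
    proof (cases "x \<in> W")
      case False
      then have "conn A p x \<or> conn A q x" using x by (auto simp: W_def)
      then have "conn D p x \<or> conn D q x" using \<open>\<And>x y. conn A x y \<Longrightarrow> conn D x y\<close> by blast
      then have "cl D p = cl D x \<or> cl D q = cl D x"
        using cl_eq[OF V(2) x, of D] cl_eq[OF V(3) x, of D] by blast
      then show ?thesis by auto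
    qed auto
    then have "cl D ` V \<subseteq> insert (cl D p) (insert (cl D q) (cl D ` W))" by blast
    moreover have "W \<subseteq> V" by (auto simp: W_def)
    ultimately show ?thesis using V(2,3) by blast
  qed
  have nin: "cl A p \<notin> cl A ` W" "cl A q \<notin> cl A ` W" "cl A p \<noteq> cl A q"
    using cl_eq[of p _ A] cl_eq[of q _ A] V n unfolding W_def by blast+
  have B: "cl ?B p = cl ?B q" using cl_eq[OF V(2,3), of ?B] pq by blast
  have ninB: "cl ?B q \<notin> cl ?B ` W"
  proof
    assume "cl ?B q \<in> cl ?B ` W"
    then obtain x where x: "x \<in> W" "cl ?B q = cl A x" using W by auto
    moreover have "q \<in> cl ?B q" using V by (simp add: cl_def)
    ultimately have "conn A x q" by (auto simp: cl_def)
    then show False using x conn_sym[of A x q] by (simp add: W_def)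
  qed
  have BW: "cl ?B ` W = cl A ` W" using W by auto
  have finW: "finite (cl A ` W)" using V by (simp add: W_def)
  have "card (cl A ` V) = card (insert (cl A p) (insert (cl A q) (cl A ` W)))"
    by (rule arg_cong[OF split]) assumption
  also have "\<dots> = Suc (Suc (card (cl A ` W)))"
    using nin finW by simp
  also have "Suc (card (cl A ` W)) = card (insert (cl ?B q) (cl A ` W))"
    using ninB BW finW by simp
  also have "insert (cl ?B q) (cl A ` W) = cl ?B ` V"
    using split[OF conn_sub] B BW by simp
  finally show ?thesis by (simp only: num_components_def quot)
qed

lemma num_components_bcf:
  assumes "bcf \<rho> E F" and "simple_graph V E" and "finite F" and "inj_on \<rho> E"
  shows "num_components V F + card F = card V"
  using assms(3,1)
proof (induction "card F" arbitrary: F)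
  case 0
  have "V // connected_rel V {} = (\<lambda>x. {x}) ` V"
    by (auto simp: quotient_def connected_rel_conn Image_def conn_def)
  then show ?case using 0 by (simp add: num_components_def card_image)
next
  case (Suc n)
  then have "F \<noteq> {}" by auto
  moreover have E2: "card e = 2" if "e \<in> E" for e
    using assms(2) that by (simp add: simple_graph_def)
  ultimately obtain p q where pq: "{p, q} \<in> F" "bcf \<rho> E (F - {{p, q}})" "\<not> conn (F - {{p, q}}) p q"
    using bcf_max_edge[OF Suc.prems(2,1) _ assms(4) E2] by blast
  have "p \<in> V \<and> q \<in> V \<and> finite V"
    using pq(1) bcf_subset[OF Suc.prems(2)] assms(2) unfolding simple_graph_def by blast
  then have "num_components V (F - {{p, q}}) = Suc (num_components V (insert {p, q} (F - {{p, q}})))"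
    by (intro num_components_insert pq(3)) auto
  moreover have card: "card F = Suc (card (F - {{p, q}}))"
    using pq(1) Suc.prems(1) by (metis card.remove)
  moreover have "num_components V (F - {{p, q}}) + card (F - {{p, q}}) = card V"
    by (rule Suc.hyps(1)) (use card Suc.hyps(2) Suc.prems(1) pq(2) in auto)
  moreover have "insert {p, q} (F - {{p, q}}) = F" using pq(1) by auto
  ultimately show ?case by simp
qed

lemma sum_involution_eq_0:
  fixes f :: "'b \<Rightarrow> complex"
  assumes "\<And>A. A \<in> N \<Longrightarrow> t A \<in> N" and "\<And>A. A \<in> N \<Longrightarrow> t (t A) = A"
    and "\<And>A. A \<in> N \<Longrightarrow> f (t A) = - f A"
  shows "sum f N = 0"
proof -
  have "bij_betw t N N"
    by (rule bij_betw_byWitness[where f' = t]) (use assms(1,2) in auto)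
  then have "sum f N = (\<Sum>A\<in>N. f (t A))"
    by (rule sum.reindex_bij_betw[symmetric])
  also have "\<dots> = - sum f N"
    using assms(3) by (simp flip: sum_negf)
  finally show ?thesis by simp
qed

text \<open>Whitney's cancellation: a set that is not broken-circuit-free is paired with the set obtained
  by toggling the smallest edge whose end points are joined by smaller edges of the set.\<close>

lemma sum_signed_eq_sum_bcf:
  fixes \<phi> :: "'a set set \<Rightarrow> complex"
  assumes fin: "finite E" and inj: "inj_on \<rho> E"
    and \<phi>: "\<And>p q A. conn A p q \<Longrightarrow> \<phi> (insert {p, q} A) = \<phi> A"
  shows "(\<Sum>A\<in>Pow E. (-1) ^ card A * \<phi> A) = (\<Sum>F | bcf \<rho> E F. (-1) ^ card F * \<phi> F)"
proof -
  \<comment> \<open>\<open>X A\<close> holds the edges that witness a broken circuit in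
    \<open>A\<close>. Whether \<open>e\<close> belongs to it depends only on the edges of
    \<open>A\<close> below \<open>e\<close>.\<close>
  define X where "X A = {e \<in> E. \<exists>p q. e = {p, q} \<and> p \<noteq> q \<and> conn {f \<in> A. \<rho> f < \<rho> e} p q}" for A
  define m where "m A = the_inv_into E \<rho> (Min (\<rho> ` X A))" for A
  define t where "t A = (if m A \<in> A then A - {m A} else insert (m A) A)" for A
  define N where "N = {A \<in> Pow E. \<not> bcf \<rho> E A}"
  have finX: "finite (X A)" for A using fin by (simp add: X_def)
  have bcf_iff: "bcf \<rho> E A \<longleftrightarrow> X A = {}" if "A \<subseteq> E" for A
    using that by (fastforce simp: bcf_def X_def)
  have m: "m A \<in> X A" "\<And>e. e \<in> X A \<Longrightarrow> \<rho> (m A) \<le> \<rho> e" if "X A \<noteq> {}" for A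
  proof -
    have "Min (\<rho> ` X A) \<in> \<rho> ` X A" using finX that by simp
    then obtain e where e: "e \<in> X A" "\<rho> e = Min (\<rho> ` X A)" by force
    moreover have "e \<in> E" using e by (auto simp: X_def)
    ultimately have "m A = e" using inj by (metis m_def the_inv_into_f_f)
    then show "m A \<in> X A" "\<And>e. e \<in> X A \<Longrightarrow> \<rho> (m A) \<le> \<rho> e" using e finX by auto
  qed
  have t: "t A \<in> N \<and> m (t A) = m A" if "A \<in> N" for A
  proof -
    have A: "A \<subseteq> E" "X A \<noteq> {}" using that bcf_iff by (auto simp: N_def)
    have mE: "m A \<in> E" using m(1)[OF A(2)] by (auto simp: X_def)
    have tE: "t A \<subseteq> E" using A mE by (auto simp: t_def)
    \<comment> \<open>Toggling \<open>m A\<close> changes no edge strictly below \<open>m A\<close>,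
      so no witness up to \<open>m A\<close> appears or disappears. The smallest witness therefore
      stays the same, which makes \<open>t\<close> an involution.\<close>
    have below: "e \<in> X (t A) \<longleftrightarrow> e \<in> X A" if "\<rho> e \<le> \<rho> (m A)" for e
    proof -
      have "{f \<in> t A. \<rho> f < \<rho> e} = {f \<in> A. \<rho> f < \<rho> e}"
        using that by (auto simp: t_def)
      then show ?thesis by (simp add: X_def)
    qed
    have mt: "m A \<in> X (t A)" using below m(1)[OF A(2)] by simp
    then have ne: "X (t A) \<noteq> {}" by auto
    have "\<rho> (m (t A)) \<le> \<rho> (m A)" using m(2)[OF ne mt] .
    moreover have "m (t A) \<in> X A" using below m(1)[OF ne] calculation by blast
    ultimately have "\<rho> (m (t A)) = \<rho> (m A)" using m(2)[OF A(2)] by (metis antisym)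
    moreover have "m (t A) \<in> E" using m(1)[OF ne] by (simp add: X_def)
    ultimately have "m (t A) = m A" using mE inj_on_eq_iff[OF inj] by blast
    then show ?thesis using tE ne bcf_iff by (auto simp: N_def)
  qed
  have "(\<Sum>A\<in>N. (-1) ^ card A * \<phi> A) = 0"
  proof (rule sum_involution_eq_0[where t = t])
    fix A assume A: "A \<in> N"
    show "t A \<in> N" using t A by blast
    show "t (t A) = A" using t[OF A] by (auto simp: t_def)
    have AE: "A \<subseteq> E" "X A \<noteq> {}" using A bcf_iff by (auto simp: N_def)
    then have finA: "finite A" using fin finite_subset by blast
    obtain p q where pq: "m A = {p, q}" "conn {f \<in> A. \<rho> f < \<rho> (m A)} p q"
      using m(1)[OF AE(2)] by (auto simp: X_def)
    have c: "conn (A - {m A}) p q" by (rule conn_mono[OF pq(2)]) auto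
    show "(-1) ^ card (t A) * \<phi> (t A) = - ((-1) ^ card A * \<phi> A)"
    proof (cases "m A \<in> A")
      case True
      then have "\<phi> A = \<phi> (A - {m A})" using \<phi>[OF c] pq by (simp add: insert_absorb)
      moreover have "card A = Suc (card (A - {m A}))" using True finA by (metis card.remove)
      then have "(-1) ^ card A = - ((-1) ^ card (A - {m A}) :: complex)" by (simp only: power_Suc) simp
      moreover have "t A = A - {m A}" using True by (simp add: t_def)
      ultimately show ?thesis by simp
    next
      case False
      then have "\<phi> (insert (m A) A) = \<phi> A" using \<phi>[of A p q] c pq by simp
      then show ?thesis using False finA by (simp add: t_def)
    qed
  qed
  moreover have "Pow E = {F. bcf \<rho> E F} \<union> N" by (auto simp: N_def bcf_def)
  moreover have "{F. bcf \<rho> E F} \<inter> N = {}" by (auto simp: N_def)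
  moreover have "finite {F. bcf \<rho> E F}" using finite_bcf[OF fin, of \<rho> "\<lambda>_. True"] by simp
  moreover have "finite N" using fin by (simp add: N_def)
  ultimately show ?thesis by (simp add: sum.union_disjoint)
qed

text \<open>This is \<open>(- x) ^ card V\<close> times the chromatic polynomial at
  \<open>- inverse x\<close>, with the powers combined so that \<open>x = 0\<close> is allowed. The
  exponent is the rank of \<open>A\<close>; for finite \<open>V\<close> the subtraction is never
  truncated.\<close>

definition bcf_fun :: "'a set \<Rightarrow> complex \<Rightarrow> 'a set set \<Rightarrow> complex" where
  "bcf_fun V x E = (\<Sum>A\<in>Pow E. (-1) ^ card A * (- x) ^ (card V - num_components V A))"

lemma simple_graph_subset: "simple_graph V E \<Longrightarrow> E' \<subseteq> E \<Longrightarrow> simple_graph V E'"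
  by (auto simp: simple_graph_def)

lemma simple_graph_finite: "simple_graph V E \<Longrightarrow> finite E"
  by (rule finite_subset[of _ "Pow V"]) (auto simp: simple_graph_def)

lemma simple_graph_card: "simple_graph V E \<Longrightarrow> e \<in> E \<Longrightarrow> card e = 2"
  by (auto simp: simple_graph_def)

text \<open>The rank depends only on connectivity, so Whitney's cancellation applies. A surviving
  set is a forest of rank \<open>card F\<close>, and the two signs cancel.\<close>

lemma bcf_fun_eq_sum_bcf:
  assumes "simple_graph V E" and "inj_on \<rho> E"
  shows "bcf_fun V x E = (\<Sum>F | bcf \<rho> E F. x ^ card F)"
proof -
  have "bcf_fun V x E =
      (\<Sum>F | bcf \<rho> E F. (-1) ^ card F * (- x) ^ (card V - num_components V F))"
    unfolding bcf_fun_def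
  proof (rule sum_signed_eq_sum_bcf[OF simple_graph_finite[OF assms(1)] assms(2)])
    fix p q :: 'a and A assume "conn A p q"
    then show "(- x) ^ (card V - num_components V (insert {p, q} A)) =
        (- x) ^ (card V - num_components V A)"
      using num_components_cong[OF conn_insert_redundant, of A p q V] by simp
  qed
  also have "\<dots> = (\<Sum>F | bcf \<rho> E F. x ^ card F)"
  proof (rule sum.cong)
    fix F assume "F \<in> {F. bcf \<rho> E F}"
    then have F: "bcf \<rho> E F" by simp
    have "finite F"
      using finite_subset[OF bcf_subset[OF F] simple_graph_finite[OF assms(1)]] .
    then have "card V - num_components V F = card F"
      using num_components_bcf[OF F assms(1) _ assms(2)] by simp
    then show "(-1) ^ card F * (- x) ^ (card V - num_components V F) = x ^ card F"
      by (simp flip: power_mult_distrib)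
  qed simp
  finally show ?thesis .
qed

lemma chromatic_poly_eq_bcf_fun:
  assumes "simple_graph V E" and "x \<noteq> 0"
  shows "poly (chromatic_poly V E) x = x ^ card V * bcf_fun V (- inverse x) E"
proof -
  have "finite V" using assms(1) by (simp add: simple_graph_def)
  have "x ^ num_components V A = x ^ card V * inverse x ^ (card V - num_components V A)" for A
  proof -
    have "x ^ card V = x ^ num_components V A * x ^ (card V - num_components V A)"
      using num_components_le[OF \<open>finite V\<close>, of A] by (simp flip: power_add)
    then show ?thesis using assms(2) by (simp add: power_inverse)
  qed
  then show ?thesis
    by (simp add: chromatic_poly_def bcf_fun_def poly_sum poly_monom sum_distrib_left mult_ac)
qed

text \<open>The largest edge lies below no other, so it matters only for its own condition, and this
  one concerns the set without it. The broken-circuit-free sets thus come in pairs with and without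
  \<open>{u, v}\<close>, whence \<open>1 + x\<close>. The subtracted sum runs over the sets of the
  smaller graph that violate the new condition.\<close>

lemma bcf_fun_max_edge:
  assumes V: "simple_graph V E" and e: "{u, v} \<in> E" and inj: "inj_on \<rho> E"
    and max: "\<And>f. f \<in> E - {{u, v}} \<Longrightarrow> \<rho> f < \<rho> {u, v}"
  shows "bcf_fun V x E = (1 + x) * (bcf_fun V x (E - {{u, v}}) -
    (\<Sum>F | bcf \<rho> (E - {{u, v}}) F \<and> conn F u v. x ^ card F))"
proof -
  let ?e = "{u, v}"
  let ?E = "E - {?e}"
  define B where "B = {F. bcf \<rho> ?E F \<and> \<not> conn F u v}"
  have finE: "finite ?E" using simple_graph_finite[OF V] by simp
  have uv: "u \<noteq> v" using simple_graph_card[OF V e] by auto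
  have below: "{f \<in> F. \<rho> f < \<rho> ?e} = F - {?e}" if "F \<subseteq> E" for F
    using that max by auto
  have below': "{f \<in> F. \<rho> f < \<rho> f'} = {f \<in> F - {?e}. \<rho> f < \<rho> f'}" if "f' \<in> ?E" for F f'
    using max[OF that] by auto
  have iff: "bcf \<rho> E F \<longleftrightarrow> F - {?e} \<in> B" if F: "F \<subseteq> E" for F
  proof
    assume b: "bcf \<rho> E F"
    have "bcf \<rho> ?E (F - {?e})" by (rule bcf_mono[OF b]) (use F in auto)
    moreover have "\<not> conn (F - {?e}) u v" using bcfD[OF b e uv] below[OF F] by simp
    ultimately show "F - {?e} \<in> B" by (simp add: B_def)
  next
    assume "F - {?e} \<in> B"
    then have b: "bcf \<rho> ?E (F - {?e})" and n: "\<not> conn (F - {?e}) u v" by (auto simp: B_def)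
    show "bcf \<rho> E F"
      unfolding bcf_def
    proof (intro conjI allI impI)
      fix p q assume pq: "{p, q} \<in> E" "p \<noteq> q"
      show "\<not> conn {f \<in> F. \<rho> f < \<rho> {p, q}} p q"
      proof (cases "{p, q} = ?e")
        case True
        then have "p = u \<and> q = v \<or> p = v \<and> q = u" by (auto simp: doubleton_eq_iff)
        then show ?thesis using n conn_sym[of "F - {?e}" v u] below[OF F] True by auto
      next
        case False
        then have "{p, q} \<in> ?E" using pq by simp
        then show ?thesis using bcfD[OF b _ pq(2)] below'[of "{p, q}" F] by simp
      qed
    qed (fact F)
  qed
  have B_sub: "F \<subseteq> E \<and> ?e \<notin> F" if "F \<in> B" for F
    using that bcf_subset[of \<rho> ?E F] by (auto simp: B_def)
  have "{F. bcf \<rho> E F} = B \<union> insert ?e ` B"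
  proof (intro equalityI subsetI)
    fix F assume "F \<in> {F. bcf \<rho> E F}"
    then have "F - {?e} \<in> B" using iff[of F] bcf_subset[of \<rho> E F] by simp
    moreover have "F = F - {?e} \<or> F = insert ?e (F - {?e})" by auto
    ultimately show "F \<in> B \<union> insert ?e ` B" by (metis UnI1 UnI2 imageI)
  next
    fix F assume "F \<in> B \<union> insert ?e ` B"
    then obtain F' where F': "F' \<in> B" "F = F' \<or> F = insert ?e F'" by auto
    then have "F - {?e} = F'" "F \<subseteq> E" using B_sub[OF F'(1)] e by auto
    then show "F \<in> {F. bcf \<rho> E F}" using iff[of F] F'(1) by simp
  qed
  moreover have "finite B" unfolding B_def by (rule finite_bcf[OF finE])
  moreover have "B \<inter> insert ?e ` B = {}" using B_sub by auto
  moreover have "inj_on (insert ?e) B"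
  proof (rule inj_onI)
    fix F F' assume "F \<in> B" "F' \<in> B" "insert ?e F = insert ?e F'"
    then show "F = F'" using B_sub[of F] B_sub[of F'] by (simp add: insert_ident)
  qed
  moreover have "x ^ card (insert ?e F) = x * x ^ card F" if "F \<in> B" for F
  proof -
    have "finite F" by (rule finite_subset[OF _ simple_graph_finite[OF V]]) (use B_sub[OF that] in simp)
    then show ?thesis using B_sub[OF that] by simp
  qed
  ultimately have "bcf_fun V x E = (1 + x) * (\<Sum>F\<in>B. x ^ card F)"
    by (simp add: bcf_fun_eq_sum_bcf[OF V inj] sum.union_disjoint sum.reindex
        sum_distrib_left[symmetric] ring_distribs)
  moreover have "bcf_fun V x ?E =
      (\<Sum>F\<in>B. x ^ card F) + (\<Sum>F | bcf \<rho> ?E F \<and> conn F u v. x ^ card F)"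
  proof -
    have "bcf_fun V x ?E = (\<Sum>F | bcf \<rho> ?E F. x ^ card F)"
      by (rule bcf_fun_eq_sum_bcf)
        (use simple_graph_subset[OF V] inj in \<open>auto intro: inj_on_subset\<close>)
    also have "{F. bcf \<rho> ?E F} = B \<union> {F. bcf \<rho> ?E F \<and> conn F u v}"
      by (auto simp: B_def)
    also have "(\<Sum>F\<in>\<dots>. x ^ card F) =
        (\<Sum>F\<in>B. x ^ card F) + (\<Sum>F | bcf \<rho> ?E F \<and> conn F u v. x ^ card F)"
      by (rule sum.union_disjoint)
        (use finite_bcf[OF finE] in \<open>auto simp: B_def\<close>)
    finally show ?thesis .
  qed
  ultimately show ?thesis by simp
qed

section \<open>Splitting off the component of a vertex\<close>

lemma edge_subset_component:
  assumes "e \<in> T" and "card e = 2" and "x \<in> e" and "conn T u x"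
  shows "e \<subseteq> {z. conn T u z}"
proof -
  obtain y where "e = {x, y}" using assms(2,3) by (auto simp: card_2_iff)
  then show ?thesis using assms(1,4) conn_trans[OF assms(4) conn_edge[of x y T]] by auto
qed

definition component_edges :: "'a \<Rightarrow> 'a set set \<Rightarrow> 'a set set" where
  "component_edges u F = {e \<in> F. \<exists>x\<in>e. conn F u x}"

lemma conn_component_edges:
  assumes "\<And>e. e \<in> F \<Longrightarrow> card e = 2"
  shows "conn (component_edges u F) u z \<longleftrightarrow> conn F u z"
proof
  let ?C = "{z. conn F u z}"
  assume "conn F u z"
  then have c: "conn (component_edges u F \<union> (F - component_edges u F)) u z"
    by (rule conn_mono) auto
  have "e \<subseteq> ?C" if e: "e \<in> component_edges u F" for e
  proof -
    obtain x where "e \<in> F" "x \<in> e" "conn F u x"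
      using e unfolding component_edges_def by blast
    then show ?thesis using assms by (intro edge_subset_component)
  qed
  moreover have "e \<inter> ?C = {}" if "e \<in> F - component_edges u F" for e
    using that by (auto simp: component_edges_def)
  ultimately show "conn (component_edges u F) u z"
    using conn_separated[OF c, of ?C] by simp
next
  assume "conn (component_edges u F) u z"
  then show "conn F u z" by (rule conn_mono) (auto simp: component_edges_def)
qed

text \<open>No edge of \<open>T \<union> B\<close> leaves the vertex set of \<open>T\<close>. A
  forbidden connection would run entirely in \<open>T\<close>, or entirely in \<open>B\<close>
  between vertices outside it, and then \<open>{p, q}\<close> is an edge of the reduced
  graph.\<close>

lemma bcf_union_tree:
  assumes T: "bcf \<rho> E T" "T \<in> rooted_trees E u" and B: "bcf \<rho> (avoid E {z. conn T u z}) B"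
    and E2: "\<And>e. e \<in> E \<Longrightarrow> card e = 2"
  shows "bcf \<rho> E (T \<union> B)" and "component_edges u (T \<union> B) = T" and "T \<inter> B = {}"
    and "conn (T \<union> B) u z \<longleftrightarrow> conn T u z"
proof -
  let ?C = "{z. conn T u z}"
  have TE: "T \<subseteq> E" using T(1) by (rule bcf_subset)
  have TC: "e \<subseteq> ?C" if e: "e \<in> T" for e
  proof -
    obtain x where "x \<in> e" "conn T u x" using T(2) e unfolding rooted_trees_def by blast
    moreover have "card e = 2" using E2 TE e by auto
    ultimately show ?thesis using edge_subset_component[OF e] by simp
  qed
  have BC: "e \<inter> ?C = {}" "e \<in> E" if "e \<in> B" for e
    using that bcf_subset[OF B] by (auto simp: avoid_def)
  have conn_iff: "conn (T \<union> B) u z \<longleftrightarrow> conn T u z" for z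
    using conn_separated[of T B u z ?C, OF _ TC BC(1)] conn_mono[of T u z "T \<union> B"] by auto
  then show "conn (T \<union> B) u z \<longleftrightarrow> conn T u z" .
  have "e \<notin> B" if "e \<in> T" for e
  proof
    assume "e \<in> B"
    then have "e = {}" using TC[OF that] BC(1) by blast
    then show False using E2[OF BC(2)[OF \<open>e \<in> B\<close>]] by simp
  qed
  then show "T \<inter> B = {}" by (simp add: disjoint_iff)
  show "component_edges u (T \<union> B) = T"
    using BC(1) T(2) by (auto simp: component_edges_def conn_iff rooted_trees_def)
  show "bcf \<rho> E (T \<union> B)"
    unfolding bcf_def
  proof (intro conjI allI impI notI)
    fix p q
    assume pq: "{p, q} \<in> E" "p \<noteq> q" and c: "conn {f \<in> T \<union> B. \<rho> f < \<rho> {p, q}} p q"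
    have "conn ({f \<in> T. \<rho> f < \<rho> {p, q}} \<union> {f \<in> B. \<rho> f < \<rho> {p, q}}) p q"
      by (rule conn_mono[OF c]) auto
    then have sep: "(p \<in> ?C \<longrightarrow> q \<in> ?C \<and> conn {f \<in> T. \<rho> f < \<rho> {p, q}} p q) \<and>
        (p \<notin> ?C \<longrightarrow> q \<notin> ?C \<and> conn {f \<in> B. \<rho> f < \<rho> {p, q}} p q)"
      by (rule conn_separated) (use TC BC(1) in auto)
    show False
    proof (cases "p \<in> ?C")
      case True
      then show False using sep bcfD[OF T(1) pq] by simp
    next
      case False
      then have "{p, q} \<in> avoid E ?C" using sep pq by (auto simp: avoid_def)
      then show False using sep False bcfD[OF B _ pq(2)] by simp
    qed
  qed (use TE BC in auto)
qed

lemma bcf_component: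
  assumes F: "bcf \<rho> E F" and fin: "finite E" and inj: "inj_on \<rho> E"
    and E2: "\<And>e. e \<in> E \<Longrightarrow> card e = 2"
  shows "bcf \<rho> E (component_edges u F)" and "component_edges u F \<in> rooted_trees E u"
    and "bcf \<rho> (avoid E {z. conn (component_edges u F) u z}) (F - component_edges u F)"
proof -
  have FE: "F \<subseteq> E" using F by (rule bcf_subset)
  have F2: "card e = 2" if "e \<in> F" for e using that FE E2 by auto
  note conn_iff = conn_component_edges[of F u, OF F2]
  have sub: "component_edges u F \<subseteq> F" by (auto simp: component_edges_def)
  show "bcf \<rho> E (component_edges u F)"
    by (rule bcf_mono[OF F]) (use sub FE in auto)
  have "acyclic_edges F"
    by (rule bcf_acyclic[OF F finite_subset[OF FE fin] inj E2])
  then have "acyclic_edges (component_edges u F)" using sub by (rule acyclic_edges_subset)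
  then show "component_edges u F \<in> rooted_trees E u"
    using sub FE conn_iff unfolding rooted_trees_def by (auto simp: component_edges_def)
  have "bcf \<rho> (avoid E {z. conn F u z}) (F - component_edges u F)"
    by (rule bcf_mono[OF F])
      (use FE in \<open>auto simp: avoid_def component_edges_def\<close>)
  then show "bcf \<rho> (avoid E {z. conn (component_edges u F) u z}) (F - component_edges u F)"
    by (simp add: conn_iff)
qed

text \<open>The sets are grouped by the component \<open>T\<close> of \<open>u\<close>. The
  remaining edges range over all broken-circuit-free sets of the graph without the vertices of
  \<open>T\<close>, for the same labelling, so their sum is again a value of
  \<open>bcf_fun\<close>.\<close>

lemma sum_bcf_connected:
  assumes V: "simple_graph V E" and inj: "inj_on \<rho> E"
  shows "(\<Sum>F | bcf \<rho> E F \<and> conn F u v. x ^ card F) =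
    (\<Sum>T | T \<in> rooted_trees E u \<and> bcf \<rho> E T \<and> conn T u v.
       x ^ card T * bcf_fun V x (avoid E {z. conn T u z}))"
proof -
  let ?R = "{T. T \<in> rooted_trees E u \<and> bcf \<rho> E T \<and> conn T u v}"
  let ?S = "\<lambda>T. {B. bcf \<rho> (avoid E {z. conn T u z}) B}"
  note fin = simple_graph_finite[OF V] and E2 = simple_graph_card[OF V]
  have finR: "finite ?R" using finite_rooted_trees[OF fin] by simp
  have finS: "finite (?S T)" for T
    using finite_bcf[OF finite_subset[OF avoid_subset fin], where \<rho> = \<rho> and P = "\<lambda>_. True"] by simp
  have finF: "finite F" if "bcf \<rho> E F" for F
    using finite_subset[OF bcf_subset[OF that] fin] .
  have "(\<Sum>T\<in>?R. x ^ card T * bcf_fun V x (avoid E {z. conn T u z})) =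
      (\<Sum>T\<in>?R. \<Sum>B\<in>?S T. x ^ card T * x ^ card B)"
  proof (rule sum.cong)
    fix T
    have "bcf_fun V x (avoid E {z. conn T u z}) = (\<Sum>B\<in>?S T. x ^ card B)"
      by (rule bcf_fun_eq_sum_bcf[OF simple_graph_subset[OF V avoid_subset]])
        (rule inj_on_subset[OF inj avoid_subset])
    then show "x ^ card T * bcf_fun V x (avoid E {z. conn T u z}) =
        (\<Sum>B\<in>?S T. x ^ card T * x ^ card B)"
      by (simp add: sum_distrib_left)
  qed simp
  also have "\<dots> = (\<Sum>(T, B)\<in>Sigma ?R ?S. x ^ card T * x ^ card B)"
    by (rule sum.Sigma) (use finR finS in auto)
  also have "\<dots> = (\<Sum>F | bcf \<rho> E F \<and> conn F u v. x ^ card F)"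
  proof (rule sum.reindex_bij_witness[where j = "\<lambda>(T, B). T \<union> B"
        and i = "\<lambda>F. (component_edges u F, F - component_edges u F)"])
    fix TB assume "TB \<in> Sigma ?R ?S"
    then obtain T B where TB: "TB = (T, B)" and T: "T \<in> rooted_trees E u" "bcf \<rho> E T" "conn T u v"
      and B: "bcf \<rho> (avoid E {z. conn T u z}) B" by auto
    note un = bcf_union_tree[OF T(2,1) B E2]
    show "(component_edges u (case TB of (T, B) \<Rightarrow> T \<union> B),
        (case TB of (T, B) \<Rightarrow> T \<union> B) - component_edges u (case TB of (T, B) \<Rightarrow> T \<union> B)) = TB"
      using un(2,3) by (auto simp: TB)
    show "(case TB of (T, B) \<Rightarrow> T \<union> B) \<in> {F. bcf \<rho> E F \<and> conn F u v}"
      using un(1,4) T(3) by (simp add: TB)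
    have "finite T" "finite B" using finF[OF un(1)] by auto
    then show "x ^ card (case TB of (T, B) \<Rightarrow> T \<union> B) =
        (case TB of (T, B) \<Rightarrow> x ^ card T * x ^ card B)"
      using un(3) by (simp add: TB card_Un_disjoint power_add)
  next
    fix F assume "F \<in> {F. bcf \<rho> E F \<and> conn F u v}"
    then have F: "bcf \<rho> E F" and c: "conn F u v" by auto
    have F2: "card e = 2" if "e \<in> F" for e using that bcf_subset[OF F] E2 by auto
    have "component_edges u F \<union> (F - component_edges u F) = F" by (auto simp: component_edges_def)
    then show "(case (component_edges u F, F - component_edges u F) of (T, B) \<Rightarrow> T \<union> B) = F"
      by simp
    show "(component_edges u F, F - component_edges u F) \<in> Sigma ?R ?S"
      using bcf_component[OF F fin inj E2] conn_component_edges[of F u v, OF F2] c by simp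
  qed
  finally show ?thesis ..
qed

section \<open>Weighted counts of rooted trees\<close>

definition nbrs :: "'a set set \<Rightarrow> 'a \<Rightarrow> 'a set" where
  "nbrs E u = {w. {u, w} \<in> E}"

lemma nbrs_mono: "E' \<subseteq> E \<Longrightarrow> nbrs E' u \<subseteq> nbrs E u"
  by (auto simp: nbrs_def)

lemma finite_nbrs:
  assumes "simple_graph V E"
  shows "finite (nbrs E u)"
  by (rule finite_subset[of _ V]) (use assms in \<open>auto simp: nbrs_def simple_graph_def\<close>)

lemma card_nbrs_mono: "simple_graph V E \<Longrightarrow> E' \<subseteq> E \<Longrightarrow> card (nbrs E' u) \<le> card (nbrs E u)"
  by (rule card_mono[OF finite_nbrs nbrs_mono])

lemma nbrs_irrefl: "simple_graph V E \<Longrightarrow> u \<notin> nbrs E u"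
  using simple_graph_card[of V E "{u, u}"] by (auto simp: nbrs_def)

lemma sum_le_inj:
  fixes f :: "'b \<Rightarrow> real"
  assumes "inj_on h A" and "h ` A \<subseteq> B" and "finite B"
    and "\<And>x. x \<in> A \<Longrightarrow> f x \<le> g (h x)" and "\<And>y. y \<in> B \<Longrightarrow> 0 \<le> g y"
  shows "sum f A \<le> sum g B"
proof -
  have "sum f A \<le> sum (g \<circ> h) A" by (rule sum_mono) (simp add: assms(4))
  also have "\<dots> = sum g (h ` A)" by (rule sum.reindex[OF assms(1), symmetric])
  also have "\<dots> \<le> sum g B" by (rule sum_mono2) (use assms in auto)
  finally show ?thesis .
qed

lemma sum_Times_product:
  fixes c :: real
  shows "(\<Sum>(x, y)\<in>R \<times> S. c * (f x * g y)) = c * (sum f R * sum g S)"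
proof -
  have "sum f R * sum g S = (\<Sum>(x, y)\<in>R \<times> S. f x * g y)"
    by (simp only: sum_product sum.cartesian_product)
  then show ?thesis by (simp add: sum_distrib_left case_prod_beta)
qed

definition tree_sum :: "real \<Rightarrow> 'a set set \<Rightarrow> 'a \<Rightarrow> real" where
  "tree_sum c E u = (\<Sum>T\<in>rooted_trees E u. c ^ card T)"

definition path_tree_sum :: "real \<Rightarrow> 'a set set \<Rightarrow> 'a \<Rightarrow> 'a \<Rightarrow> real" where
  "path_tree_sum c E u v = (\<Sum>T | T \<in> rooted_trees E u \<and> conn T u v. c ^ card T)"

lemma tree_sum_nonneg: "0 \<le> c \<Longrightarrow> 0 \<le> tree_sum c E u"
  by (simp add: tree_sum_def sum_nonneg)

lemma path_tree_sum_nonneg: "0 \<le> c \<Longrightarrow> 0 \<le> path_tree_sum c E u v"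
  by (simp add: path_tree_sum_def sum_nonneg)

lemma branch_decompose:
  assumes "{u, w} \<in> T"
  shows "T = insert {u, w} ((T - {{u, w}} - branch u w T) \<union> branch u w T)"
  using assms by (auto simp: branch_def)

lemma power_card_branch:
  assumes "{u, w} \<in> T" and "finite T"
  shows "(c :: real) ^ card T = c * (c ^ card (T - {{u, w}} - branch u w T) * c ^ card (branch u w T))"
proof -
  let ?Tu = "T - {{u, w}} - branch u w T" and ?Tw = "branch u w T"
  have sub: "?Tw \<subseteq> T" and notin: "{u, w} \<notin> ?Tu \<union> ?Tw" and dis: "?Tu \<inter> ?Tw = {}"
    by (auto simp: branch_def)
  have fin: "finite ?Tu" "finite ?Tw"
    using assms(2) finite_subset[OF sub] by simp_all
  have "card T = card (insert {u, w} (?Tu \<union> ?Tw))"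
    by (rule arg_cong[OF branch_decompose[OF assms(1)]])
  also have "\<dots> = Suc (card (?Tu \<union> ?Tw))"
    by (rule card_insert_disjoint) (use fin notin in auto)
  also have "\<dots> = Suc (card ?Tu + card ?Tw)"
    by (simp only: card_Un_disjoint[OF fin dis])
  finally show ?thesis by (simp only: power_Suc power_add)
qed

text \<open>Trees without the edge account for the \<open>1\<close>. A tree with the edge is
  determined by its two parts, which gives an injection into pairs; it need not be onto, since the
  members of a pair may overlap.\<close>

lemma tree_sum_edge:
  assumes V: "simple_graph V E" and e: "{u, w} \<in> E" and c: "0 \<le> c"
  shows "tree_sum c E u \<le>
    tree_sum c (E - {{u, w}}) u * (1 + c * tree_sum c (avoid E {u}) w)"
proof -
  let ?e = "{u, w}"
  let ?A = "{T \<in> rooted_trees E u. ?e \<in> T}"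
  let ?R = "rooted_trees (E - {?e}) u" and ?S = "rooted_trees (avoid E {u}) w"
  let ?h = "\<lambda>T. (T - {?e} - branch u w T, branch u w T)"
  note finE = simple_graph_finite[OF V]
  have fin: "finite ?R" "finite ?S" "finite ?A"
    using finite_rooted_trees[OF finE] finite_rooted_trees[OF finite_subset[OF Diff_subset finE]]
      finite_rooted_trees[OF finite_subset[OF avoid_subset finE]] by auto
  have un: "rooted_trees E u = ?R \<union> ?A"
    unfolding rooted_trees_def by blast
  have "(\<Sum>T\<in>?R \<union> ?A. c ^ card T) = (\<Sum>T\<in>?R. c ^ card T) + (\<Sum>T\<in>?A. c ^ card T)"
    by (rule sum.union_disjoint) (use fin in \<open>auto simp: rooted_trees_def\<close>)
  then have "tree_sum c E u = tree_sum c (E - {?e}) u + (\<Sum>T\<in>?A. c ^ card T)"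
    by (simp only: tree_sum_def un[symmetric])
  also have "(\<Sum>T\<in>?A. c ^ card T) \<le> (\<Sum>(Tu, Tw)\<in>?R \<times> ?S. c * (c ^ card Tu * c ^ card Tw))"
  proof (rule sum_le_inj[where h = ?h])
    show "inj_on ?h ?A"
    proof (rule inj_onI)
      fix T T' assume T: "T \<in> ?A" "T' \<in> ?A" and eq: "?h T = ?h T'"
      have "T = insert ?e (fst (?h T) \<union> snd (?h T))"
        using branch_decompose[of u w T] T(1) by simp
      also have "\<dots> = insert ?e (fst (?h T') \<union> snd (?h T'))" by (simp only: eq)
      also have "\<dots> = T'" using branch_decompose[of u w T'] T(2) by simp
      finally show "T = T'" .
    qed
    show "?h ` ?A \<subseteq> ?R \<times> ?S"
    proof
      fix p assume "p \<in> ?h ` ?A"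
      then obtain T where T: "T \<in> rooted_trees E u" "?e \<in> T" and p: "p = ?h T" by blast
      show "p \<in> ?R \<times> ?S"
        unfolding p mem_Times_iff
        using rooted_tree_split(1,2)[OF T simple_graph_card[OF V]] by simp
    qed
    fix T assume "T \<in> ?A"
    then have T: "?e \<in> T" "finite T"
      using finite_subset[OF _ finE] by (auto simp: rooted_trees_def)
    then show "c ^ card T \<le> (\<lambda>(Tu, Tw). c * (c ^ card Tu * c ^ card Tw)) (?h T)"
      using power_card_branch[OF T, of c] by simp
  qed (use fin c in auto)
  also have "\<dots> = c * (tree_sum c (E - {?e}) u * tree_sum c (avoid E {u}) w)"
    by (simp only: tree_sum_def sum_Times_product)
  finally show ?thesis by (simp add: algebra_simps)
qed

text \<open>The edges at \<open>u\<close> are removed one at a time, each for a factor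
  \<open>1 + c * b\<close>. The tree beyond an edge lives in a smaller graph, where induction bounds
  its sum by \<open>(1 + c * b) ^ \<Delta>\<close>, and \<open>bc\<close> turns this back into
  \<open>b\<close>.\<close>

lemma tree_sum_le:
  fixes b c :: real
  assumes "simple_graph V E" and "\<And>z. card (nbrs E z) \<le> \<Delta>"
    and b: "0 \<le> b" and c: "0 \<le> c" and bc: "(1 + c * b) ^ \<Delta> \<le> b"
  shows "tree_sum c E u \<le> (1 + c * b) ^ card (nbrs E u)"
  using assms(1,2)
proof (induction "card E" arbitrary: E u rule: less_induct)
  case less
  note V = less.prems(1)
  note finE = simple_graph_finite[OF V]
  show ?case
  proof (cases "nbrs E u = {}")
    case True
    then have "rooted_trees E u = {{}}"
      by (intro rooted_trees_isolated simple_graph_card[OF V]) (auto simp: nbrs_def)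
    then show ?thesis using True by (simp add: tree_sum_def)
  next
    case False
    then obtain w where w: "{u, w} \<in> E" by (auto simp: nbrs_def)
    have bound: "tree_sum c E' z \<le> (1 + c * b) ^ card (nbrs E' z)" if "E' \<subset> E" for E' z
    proof (rule less.hyps)
      show "card E' < card E" by (rule psubset_card_mono[OF finE that])
      show "simple_graph V E'" using simple_graph_subset[OF V] that by blast
      show "card (nbrs E' z) \<le> \<Delta>" for z
        using le_trans[OF card_nbrs_mono[OF V psubset_imp_subset[OF that]] less.prems(2)] .
    qed
    have sub: "E - {{u, w}} \<subset> E" "avoid E {u} \<subset> E" using w by (auto simp: avoid_def)
    have y: "1 \<le> 1 + c * b" using b c by simp
    have "tree_sum c (avoid E {u}) w \<le> (1 + c * b) ^ card (nbrs (avoid E {u}) w)"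
      by (rule bound[OF sub(2)])
    also have "\<dots> \<le> (1 + c * b) ^ \<Delta>"
      using card_nbrs_mono[OF V avoid_subset, of "{u}" w] less.prems(2)[of w] y
      by (intro power_increasing) auto
    finally have Tw: "tree_sum c (avoid E {u}) w \<le> b" using bc by simp
    have "nbrs E u = insert w (nbrs (E - {{u, w}}) u)" "w \<notin> nbrs (E - {{u, w}}) u"
      using w by (auto simp: nbrs_def doubleton_eq_iff)
    moreover have "finite (nbrs (E - {{u, w}}) u)"
      by (rule finite_nbrs[OF simple_graph_subset[OF V]]) auto
    ultimately have card: "card (nbrs E u) = Suc (card (nbrs (E - {{u, w}}) u))" by simp
    have "tree_sum c E u \<le> tree_sum c (E - {{u, w}}) u * (1 + c * tree_sum c (avoid E {u}) w)"
      by (rule tree_sum_edge[OF V w c])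
    also have "\<dots> \<le> (1 + c * b) ^ card (nbrs (E - {{u, w}}) u) * (1 + c * b)"
      by (intro mult_mono bound[OF sub(1)] add_left_mono mult_left_mono Tw)
        (use b c tree_sum_nonneg[OF c, of "avoid E {u}" w] in auto)
    finally show ?thesis by (simp add: card mult.commute)
  qed
qed

section \<open>Paths\<close>

definition paths :: "'a set set \<Rightarrow> 'a \<Rightarrow> 'a \<Rightarrow> 'a list set" where
  "paths E u v = {p. p \<noteq> [] \<and> hd p = u \<and> last p = v \<and> distinct p \<and>
     successively (\<lambda>x y. {x, y} \<in> E) p}"

definition path_sum :: "real \<Rightarrow> 'a set set \<Rightarrow> 'a \<Rightarrow> 'a \<Rightarrow> real" where
  "path_sum t E u v = (\<Sum>p\<in>paths E u v. t ^ (length p - 1))"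

lemma paths_subset_vertices:
  assumes "successively (\<lambda>x y. {x, y} \<in> E) p" and "p \<noteq> []" and "\<And>e. e \<in> E \<Longrightarrow> e \<subseteq> X"
    and "hd p \<in> X"
  shows "set p \<subseteq> X"
  using assms(1,2,4)
proof (induction p)
  case (Cons x p)
  show ?case
  proof (cases p)
    case (Cons y q)
    then have "{x, y} \<in> E" using Cons.prems by simp
    then have "y \<in> X" using assms(3) by blast
    then show ?thesis using Cons.IH Cons.prems Cons by simp
  qed (use Cons in simp)
qed simp

lemma finite_paths:
  assumes "simple_graph V E"
  shows "finite (paths E u v)"
proof (rule finite_subset)
  show "paths E u v \<subseteq> {p. set p \<subseteq> insert u V \<and> distinct p}"
  proof
    fix p assume "p \<in> paths E u v"
    then have p: "successively (\<lambda>x y. {x, y} \<in> E) p" "p \<noteq> []" "hd p = u" "distinct p"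
      by (auto simp: paths_def)
    have "set p \<subseteq> insert u V"
      by (rule paths_subset_vertices[OF p(1,2)]) (use assms p(3) in \<open>auto simp: simple_graph_def\<close>)
    then show "p \<in> {p. set p \<subseteq> insert u V \<and> distinct p}" using p(4) by simp
  qed
  show "finite {p. set p \<subseteq> insert u V \<and> distinct p}"
    using finite_subset_distinct[of "insert u V"] assms by (simp add: simple_graph_def)
qed

lemma path_sum_nonneg: "0 \<le> t \<Longrightarrow> 0 \<le> path_sum t E u v"
  by (simp add: path_sum_def sum_nonneg)

lemma path_sum_refl: "path_sum t E u u = 1"
proof -
  have "p = [u]" if "p \<in> paths E u u" for p
    using that by (cases p) (auto simp: paths_def split: if_splits)
  moreover have "[u] \<in> paths E u u" by (simp add: paths_def)
  ultimately have "paths E u u = {[u]}" by blast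
  then show ?thesis by (simp add: path_sum_def)
qed

lemma path_sum_sym: "path_sum t E u v = path_sum t E v u"
  unfolding path_sum_def
  by (rule sum.reindex_bij_witness[where i = rev and j = rev])
    (auto simp: paths_def hd_rev last_rev insert_commute)

lemma path_ConsD:
  assumes "p \<in> paths E u v" and "u \<noteq> v"
  obtains q where "p = u # q" and "hd q \<in> nbrs E u" and "q \<in> paths (avoid E {u}) (hd q) v"
proof -
  obtain q where p: "p = u # q" using assms(1) by (cases p) (auto simp: paths_def)
  have q: "q \<noteq> []" using assms p by (auto simp: paths_def)
  have "successively (\<lambda>x y. {x, y} \<in> E) q" and nbr: "hd q \<in> nbrs E u" and u: "u \<notin> set q"
    using assms(1) p q by (auto simp: paths_def successively_Cons nbrs_def)
  then have "successively (\<lambda>x y. {x, y} \<in> avoid E {u}) q"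
    by (elim successively_mono) (auto simp: avoid_def)
  then have "q \<in> paths (avoid E {u}) (hd q) v"
    using assms(1) p q by (auto simp: paths_def)
  with that p nbr show thesis by blast
qed

lemma path_ConsI:
  assumes "w \<in> nbrs E u" and "u \<noteq> w" and "q \<in> paths (avoid E {u}) w v"
  shows "u # q \<in> paths E u v" and "u \<notin> set q"
proof -
  have q: "successively (\<lambda>x y. {x, y} \<in> avoid E {u}) q" "q \<noteq> []" "hd q = w" "last q = v" "distinct q"
    using assms(3) by (auto simp: paths_def)
  have "set q \<subseteq> - {u}"
    by (rule paths_subset_vertices[OF q(1,2)]) (use assms q(3) in \<open>auto simp: avoid_def\<close>)
  then show u: "u \<notin> set q" by auto
  have "successively (\<lambda>x y. {x, y} \<in> E) q"
    using q(1) by (rule successively_mono) (auto simp: avoid_def)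
  then show "u # q \<in> paths E u v"
    using u q assms(1) by (simp add: paths_def successively_Cons nbrs_def)
qed

lemma path_sum_Cons:
  assumes V: "simple_graph V E" and "u \<noteq> v"
  shows "path_sum t E u v = (\<Sum>w\<in>nbrs E u. t * path_sum t (avoid E {u}) w v)"
proof -
  let ?S = "Sigma (nbrs E u) (\<lambda>w. paths (avoid E {u}) w v)"
  have "(\<Sum>w\<in>nbrs E u. t * path_sum t (avoid E {u}) w v) =
      (\<Sum>w\<in>nbrs E u. \<Sum>q\<in>paths (avoid E {u}) w v. t ^ length q)"
  proof (rule sum.cong)
    fix w
    have "t * t ^ (length q - 1) = t ^ length q" if "q \<in> paths (avoid E {u}) w v" for q
      using that by (cases q) (auto simp: paths_def)
    then show "t * path_sum t (avoid E {u}) w v = (\<Sum>q\<in>paths (avoid E {u}) w v. t ^ length q)"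
      by (simp add: path_sum_def sum_distrib_left)
  qed simp
  also have "\<dots> = (\<Sum>(w, q)\<in>?S. t ^ length q)"
    by (rule sum.Sigma)
      (use finite_nbrs[OF V] finite_paths[OF simple_graph_subset[OF V avoid_subset]] in auto)
  also have "\<dots> = path_sum t E u v"
    unfolding path_sum_def
  proof (rule sum.reindex_bij_witness[where i = "\<lambda>p. (hd (tl p), tl p)" and j = "\<lambda>(w, q). u # q"])
    fix wq assume "wq \<in> ?S"
    then obtain w q where wq: "wq = (w, q)" "w \<in> nbrs E u" "q \<in> paths (avoid E {u}) w v" by auto
    have "u \<noteq> w" using nbrs_irrefl[OF V] wq(2) by auto
    have "hd q = w" using wq(3) by (simp add: paths_def)
    then show "(hd (tl (case wq of (w, q) \<Rightarrow> u # q)), tl (case wq of (w, q) \<Rightarrow> u # q)) = wq"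
      by (simp add: wq(1))
    show "(case wq of (w, q) \<Rightarrow> u # q) \<in> paths E u v"
      using path_ConsI(1)[OF wq(2) \<open>u \<noteq> w\<close> wq(3)] by (simp add: wq(1))
    show "t ^ (length (case wq of (w, q) \<Rightarrow> u # q) - 1) = (case wq of (w, q) \<Rightarrow> t ^ length q)"
      by (simp add: wq(1))
  next
    fix p assume "p \<in> paths E u v"
    then obtain q where q: "p = u # q" "hd q \<in> nbrs E u" "q \<in> paths (avoid E {u}) (hd q) v"
      by (rule path_ConsD[OF _ assms(2)])
    show "(case (hd (tl p), tl p) of (w, q) \<Rightarrow> u # q) = p" by (simp add: q(1))
    show "(hd (tl p), tl p) \<in> ?S" using q by simp
  qed
  finally show ?thesis ..
qed

text \<open>A tree joining \<open>u\<close> to \<open>v\<close> is cut along its path from \<open>u\<close> to \<open>v\<close>; every vertex of the path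
  other than \<open>u\<close> contributes a factor at most \<open>b\<close> for the branches hanging off it.\<close>

lemma path_tree_sum_le:
  fixes b c :: real
  assumes "simple_graph V E" and "\<And>z. card (nbrs E z) \<le> \<Delta>"
    and b: "0 \<le> b" and c: "0 \<le> c" and bc: "(1 + c * b) ^ \<Delta> \<le> b"
  shows "path_tree_sum c E u v \<le> (1 + c * b) ^ card (nbrs E u) * path_sum (c * b) E u v"
  using assms(1,2)
proof (induction "card E" arbitrary: E u rule: less_induct)
  case less
  note V = less.prems(1)
  note finE = simple_graph_finite[OF V]
  let ?y = "1 + c * b"
  have y: "1 \<le> ?y" using b c by simp
  have deg_le: "card (nbrs E' z) \<le> card (nbrs E z)" if "E' \<subseteq> E" for E' z
    using card_nbrs_mono[OF V that] .
  have sg: "simple_graph V E'" if "E' \<subseteq> E" for E'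
    using simple_graph_subset[OF V that] .
  have tree_le: "tree_sum c E' z \<le> ?y ^ card (nbrs E z)" if "E' \<subseteq> E" for E' z
  proof -
    have "tree_sum c E' z \<le> ?y ^ card (nbrs E' z)"
      by (rule tree_sum_le[OF sg[OF that] le_trans[OF deg_le[OF that] less.prems(2)] b c bc])
    also have "\<dots> \<le> ?y ^ card (nbrs E z)" by (rule power_increasing[OF deg_le[OF that] y])
    finally show ?thesis .
  qed
  show ?case
  proof (cases "u = v")
    case True
    then have "path_tree_sum c E u v = tree_sum c E u"
      by (simp add: path_tree_sum_def tree_sum_def)
    then show ?thesis using True tree_le[of E u] by (simp add: path_sum_refl)
  next
    case False
    let ?A = "{T. T \<in> rooted_trees E u \<and> conn T u v}"
    let ?R = "\<lambda>w. rooted_trees (E - {{u, w}}) u"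
    let ?S = "\<lambda>w. {T. T \<in> rooted_trees (avoid E {u}) w \<and> conn T w v}"
    \<comment> \<open>In a tree this vertex is unique, but any choice will do: \<open>h T\<close>
      records it, so that \<open>T\<close> can be rebuilt from \<open>h T\<close>.\<close>
    define first where "first T = (SOME w. {u, w} \<in> T \<and> conn (avoid T {u}) w v)" for T
    define h where "h T = (first T, T - {{u, first T}} - branch u (first T) T, branch u (first T) T)" for T
    let ?g = "\<lambda>(w, Tu, Tw). c * (c ^ card Tu * c ^ card Tw)"
    have first: "{u, first T} \<in> T \<and> conn (avoid T {u}) (first T) v" if T: "T \<in> ?A" for T
    proof -
      have "\<exists>w. {u, w} \<in> T \<and> conn (avoid T {u}) w v"
        using T by (auto intro: conn_first_edge[OF _ False])
      then show ?thesis unfolding first_def by (rule someI_ex)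
    qed
    have finR: "finite (?R w)" and finS: "finite (?S w)" for w
      using finite_rooted_trees[OF finite_subset[OF Diff_subset finE]]
        finite_rooted_trees[OF finite_subset[OF avoid_subset finE]] by auto
    have "path_tree_sum c E u v \<le> sum ?g (Sigma (nbrs E u) (\<lambda>w. ?R w \<times> ?S w))"
      unfolding path_tree_sum_def
    proof (rule sum_le_inj[where h = h])
      show "inj_on h ?A"
      proof (rule inj_onI)
        fix T T' assume T: "T \<in> ?A" "T' \<in> ?A" and eq: "h T = h T'"
        have "T = insert {u, fst (h T)} (fst (snd (h T)) \<union> snd (snd (h T)))"
          using branch_decompose[of u "first T" T] first[OF T(1)] by (simp add: h_def)
        also have "\<dots> = insert {u, fst (h T')} (fst (snd (h T')) \<union> snd (snd (h T')))"
          by (simp only: eq)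
        also have "\<dots> = T'"
          using branch_decompose[of u "first T'" T'] first[OF T(2)] by (simp add: h_def)
        finally show "T = T'" .
      qed
      have h_mem: "h T \<in> Sigma (nbrs E u) (\<lambda>w. ?R w \<times> ?S w)" if T: "T \<in> ?A" for T
      proof -
        let ?w = "first T"
        have T': "T \<in> rooted_trees E u" "{u, ?w} \<in> T" using T first[OF T] by auto
        have "{u, ?w} \<in> E" using T' unfolding rooted_trees_def by blast
        moreover have "conn (T - {{u, ?w}}) ?w v"
        proof (rule conn_mono)
          show "conn (avoid T {u}) ?w v" using first[OF T] by simp
        qed (auto simp: avoid_def)
        ultimately show ?thesis
          using rooted_tree_split(1-3)[OF T' simple_graph_card[OF V]] by (simp add: h_def nbrs_def)
      qed
      then show "h ` ?A \<subseteq> Sigma (nbrs E u) (\<lambda>w. ?R w \<times> ?S w)" by (rule image_subsetI)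
      show "finite (Sigma (nbrs E u) (\<lambda>w. ?R w \<times> ?S w))"
        by (intro finite_SigmaI finite_nbrs[OF V] finite_cartesian_product finR finS)
      fix T assume T: "T \<in> ?A"
      then have "T \<subseteq> E" by (simp add: rooted_trees_def)
      then have "finite T" using finE by (rule finite_subset)
      then show "c ^ card T \<le> ?g (h T)"
        using power_card_branch[of u "first T" T c] first[OF T] by (simp add: h_def)
    qed (use c in auto)
    also have "\<dots> = (\<Sum>w\<in>nbrs E u. \<Sum>(Tu, Tw)\<in>?R w \<times> ?S w. c * (c ^ card Tu * c ^ card Tw))"
      by (subst sum.Sigma) (use finite_nbrs[OF V] finR finS in auto)
    also have "\<dots> = (\<Sum>w\<in>nbrs E u. c * (tree_sum c (E - {{u, w}}) u * path_tree_sum c (avoid E {u}) w v))"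
      by (simp only: tree_sum_def path_tree_sum_def sum_Times_product)
    also have "\<dots> \<le> (\<Sum>w\<in>nbrs E u. c * (?y ^ card (nbrs E u) * (b * path_sum (c * b) (avoid E {u}) w v)))"
    proof (rule sum_mono)
      fix w assume "w \<in> nbrs E u"
      then have w: "{u, w} \<in> E" by (simp add: nbrs_def)
      have "path_tree_sum c (avoid E {u}) w v \<le>
          ?y ^ card (nbrs (avoid E {u}) w) * path_sum (c * b) (avoid E {u}) w v"
      proof (rule less.hyps)
        have "avoid E {u} \<subset> E" using w by (auto simp: avoid_def)
        then show "card (avoid E {u}) < card E" by (rule psubset_card_mono[OF finE])
        show "card (nbrs (avoid E {u}) z) \<le> \<Delta>" for z
          using deg_le[OF avoid_subset, of "{u}" z] less.prems(2)[of z] by simp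
      qed (rule sg[OF avoid_subset])
      \<comment> \<open>The branches hanging off \<open>w\<close> cost at most \<open>b\<close>;
        together with the price \<open>c\<close> of the edge to \<open>w\<close> this is one step of
        weight \<open>c * b\<close> in \<open>path_sum\<close>.\<close>
      also have "\<dots> \<le> b * path_sum (c * b) (avoid E {u}) w v"
      proof (rule mult_right_mono)
        have "?y ^ card (nbrs (avoid E {u}) w) \<le> ?y ^ \<Delta>"
          using deg_le[OF avoid_subset, of "{u}" w] less.prems(2)[of w] y
          by (intro power_increasing) auto
        then show "?y ^ card (nbrs (avoid E {u}) w) \<le> b" using bc by simp
        show "0 \<le> path_sum (c * b) (avoid E {u}) w v" using b c by (intro path_sum_nonneg) simp
      qed
      finally show "c * (tree_sum c (E - {{u, w}}) u * path_tree_sum c (avoid E {u}) w v) \<le>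
          c * (?y ^ card (nbrs E u) * (b * path_sum (c * b) (avoid E {u}) w v))"
        by (intro mult_left_mono mult_mono tree_le)
          (use c y path_tree_sum_nonneg[OF c] in auto)
    qed
    also have "\<dots> = ?y ^ card (nbrs E u) * (\<Sum>w\<in>nbrs E u. c * b * path_sum (c * b) (avoid E {u}) w v)"
      by (simp add: sum_distrib_left mult_ac)
    also have "\<dots> = ?y ^ card (nbrs E u) * path_sum (c * b) E u v"
      by (simp add: path_sum_Cons[OF V False])
    finally show ?thesis .
  qed
qed

section \<open>Cycles and the girth\<close>

lemma successively_nth:
  "successively P xs \<Longrightarrow> Suc i < length xs \<Longrightarrow> P (xs ! i) (xs ! Suc i)"
  by (induction P xs arbitrary: i rule: successively.induct) (auto simp: nth_Cons split: nat.split)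

lemma cycle_edges_subset:
  assumes "successively (\<lambda>x y. {x, y} \<in> A) p" and "p \<noteq> []" and "{last p, hd p} \<in> A"
  shows "cycle_edges p \<subseteq> A"
proof
  fix f assume "f \<in> cycle_edges p"
  then obtain i where i: "i < length p" "f = {p ! i, p ! (Suc i mod length p)}"
    by (auto simp: cycle_edges_def)
  show "f \<in> A"
  proof (cases "Suc i < length p")
    case True
    then show ?thesis using successively_nth[OF assms(1) True] i by simp
  next
    case False
    then have "Suc i = length p" using i by simp
    then have "i = length p - 1" "Suc i mod length p = 0" by auto
    then have "p ! i = last p" "p ! (Suc i mod length p) = hd p"
      using assms(2) by (simp_all add: last_conv_nth hd_conv_nth)
    then show ?thesis using i assms(3) by simp
  qed
qed

lemma is_cycle_Cons_path:
  assumes V: "simple_graph V E" and v: "v \<in> nbrs E u" and w: "w \<in> nbrs E u" and "v \<noteq> w"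
    and p: "p \<in> paths (avoid E {u}) v w"
  shows "is_cycle E (u # p)"
proof -
  have "u \<noteq> v" using nbrs_irrefl[OF V] v by auto
  note up = path_ConsI[OF v this p]
  have "successively (\<lambda>x y. {x, y} \<in> E) (u # p)" "distinct (u # p)" "last (u # p) = w"
    using up(1) by (auto simp: paths_def)
  then have "cycle_edges (u # p) \<subseteq> E"
    by (intro cycle_edges_subset) (use w in \<open>auto simp: nbrs_def insert_commute\<close>)
  moreover have "length p \<ge> 2"
  proof -
    have "p \<noteq> []" "hd p \<noteq> last p" using p \<open>v \<noteq> w\<close> by (auto simp: paths_def)
    then show ?thesis by (cases p rule: remdups_adj.cases) auto
  qed
  ultimately show ?thesis using \<open>distinct (u # p)\<close> by (simp add: is_cycle_def)
qed

text \<open>Vertices may repeat, so \<open>\<Delta> ^ n\<close> bounds the number of walks with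
  \<open>n\<close> edges at once.\<close>

primrec walks :: "'a set set \<Rightarrow> nat \<Rightarrow> 'a \<Rightarrow> 'a list set" where
  "walks E 0 u = {[u]}"
| "walks E (Suc n) u = (\<Union>w\<in>nbrs E u. (#) u ` walks E n w)"

lemma card_walks_le:
  assumes V: "simple_graph V E" and deg: "\<And>z. card (nbrs E z) \<le> \<Delta>"
  shows "finite (walks E n u) \<and> card (walks E n u) \<le> \<Delta> ^ n"
proof (induction n arbitrary: u)
  case (Suc n)
  have "card (walks E (Suc n) u) \<le> (\<Sum>w\<in>nbrs E u. card ((#) u ` walks E n w))"
    by (simp add: card_UN_le[OF finite_nbrs[OF V]])
  also have "\<dots> \<le> (\<Sum>w\<in>nbrs E u. \<Delta> ^ n)"
    by (rule sum_mono) (use Suc card_image_le order_trans in blast)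
  also have "\<dots> \<le> \<Delta> ^ Suc n" using deg[of u] by simp
  finally show ?case using Suc finite_nbrs[OF V] by simp
qed simp

lemma walks_memI:
  assumes "successively (\<lambda>x y. {x, y} \<in> E) p" and "length p = Suc n" and "hd p = u"
  shows "p \<in> walks E n u"
  using assms
proof (induction n arbitrary: p u)
  case 0
  then show ?case by (cases p) auto
next
  case (Suc n)
  then obtain q where p: "p = u # q" "length q = Suc n" by (cases p) auto
  then have q: "q \<noteq> []" by auto
  have "q \<in> walks E n (hd q)"
    by (rule Suc.IH) (use Suc.prems p q in \<open>auto simp: successively_Cons\<close>)
  moreover have "hd q \<in> nbrs E u" using Suc.prems p q by (auto simp: successively_Cons nbrs_def)
  ultimately show ?case using p by auto
qed

text \<open>With the outer factor \<open>t\<close>, a path \<open>p\<close> has weight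
  \<open>t ^ length p\<close>. The list \<open>u # p\<close> is a walk with \<open>length p\<close>
  edges and closes up to a cycle with one edge more, so these lengths start at \<open>g - 1\<close>.
  Counting walks leaves a tail of the geometric series of \<open>L\<close>.\<close>

lemma sum_path_sum_le:
  fixes t L :: real
  assumes V: "simple_graph V E" and deg: "\<And>z. card (nbrs E z) \<le> \<Delta>"
    and girth: "\<And>vs. is_cycle E vs \<Longrightarrow> g \<le> length vs"
    and t: "0 \<le> t" "t * real \<Delta> \<le> L" and L: "L < 1"
  shows "t * (\<Sum>v\<in>nbrs E u. \<Sum>w\<in>nbrs E u - {v}. path_sum t (avoid E {u}) v w)
    \<le> L ^ (g - 1) / (1 - L)"
proof -
  let ?N = "nbrs E u" and ?P = "paths (avoid E {u})"
  define A where "A = Sigma (Sigma ?N (\<lambda>v. ?N - {v})) (\<lambda>(v, w). ?P v w)"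
  \<comment> \<open>The end points may be forgotten: they are the head and the last entry of
    \<open>p\<close>.\<close>
  let ?h = "\<lambda>(vw :: 'a \<times> 'a, p). (length p, u # p)"
  have finN: "finite ?N" by (rule finite_nbrs[OF V])
  have finP: "finite (?P v w)" for v w
    by (rule finite_paths[OF simple_graph_subset[OF V avoid_subset]])
  have finA: "finite A" unfolding A_def using finN finP by (intro finite_SigmaI) auto
  then have "finite ((\<lambda>(vw, p). length p) ` A)" by simp
  \<comment> \<open>A common bound on the lengths of the finitely many paths keeps the geometric sum
    finite.\<close>
  then obtain N where "\<forall>n\<in>(\<lambda>(vw, p). length p) ` A. n \<le> N"
    unfolding finite_nat_set_iff_bounded_le by blast
  then have N: "length p \<le> N" if "(vw, p) \<in> A" for vw p
    using that by force
  have L0: "0 \<le> L" using t by (meson mult_nonneg_nonneg of_nat_0_le_iff order_trans)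
  have len: "t * t ^ (length p - Suc 0) = t ^ length p" if "p \<in> ?P v w" for v w p
    using that by (cases p) (auto simp: paths_def)
  have "t * (\<Sum>v\<in>?N. \<Sum>w\<in>?N - {v}. path_sum t (avoid E {u}) v w) =
      (\<Sum>v\<in>?N. \<Sum>w\<in>?N - {v}. \<Sum>p\<in>?P v w. t ^ length p)"
    by (simp add: path_sum_def sum_distrib_left len)
  also have "\<dots> = (\<Sum>(v, w)\<in>Sigma ?N (\<lambda>v. ?N - {v}). \<Sum>p\<in>?P v w. t ^ length p)"
    by (rule sum.Sigma) (use finN in auto)
  also have "\<dots> = (\<Sum>(vw, p)\<in>A. t ^ length p)"
    unfolding A_def case_prod_beta
    by (subst sum.Sigma) (use finN finP in \<open>auto simp: case_prod_beta\<close>)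
  also have "\<dots> \<le> (\<Sum>(n, q)\<in>Sigma {g - 1..N} (\<lambda>n. walks E n u). t ^ n)"
  proof (rule sum_le_inj[where h = ?h])
    have A_mem: "p \<in> ?P v w \<and> v \<in> ?N \<and> w \<in> ?N \<and> v \<noteq> w" if "((v, w), p) \<in> A" for v w p
      using that by (auto simp: A_def)
    show "inj_on ?h A"
    proof (rule inj_onI)
      fix x y assume xy: "x \<in> A" "y \<in> A" "?h x = ?h y"
      obtain v w p v' w' p' where eq: "x = ((v, w), p)" "y = ((v', w'), p')"
        by (metis surj_pair)
      have "p = p'" using xy(3) by (simp add: eq)
      moreover have "v = hd p" "w = last p" "v' = hd p'" "w' = last p'"
        using A_mem[of v w p] A_mem[of v' w' p'] xy(1,2) by (auto simp: eq paths_def)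
      ultimately show "x = y" by (simp add: eq)
    qed
    show "?h ` A \<subseteq> Sigma {g - 1..N} (\<lambda>n. walks E n u)"
    proof (rule image_subsetI)
      fix x assume xA: "x \<in> A"
      obtain v w p where x: "x = ((v, w), p)" by (metis surj_pair)
      have p: "p \<in> ?P v w" "v \<in> ?N" "w \<in> ?N" "v \<noteq> w" using A_mem[of v w p] xA x by auto
      have cyc: "is_cycle E (u # p)" by (rule is_cycle_Cons_path[OF V p(2,3,4,1)])
      have "u \<noteq> v" using nbrs_irrefl[OF V] p(2) by auto
      then have "successively (\<lambda>x y. {x, y} \<in> E) (u # p)"
        using path_ConsI(1)[OF p(2) _ p(1)] by (simp add: paths_def)
      then have "u # p \<in> walks E (length p) u" by (rule walks_memI) auto
      moreover have "length p \<le> N" using N[of "(v, w)" p] xA x by simp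
      moreover have "g - 1 \<le> length p" using girth[OF cyc] by simp
      ultimately show "?h x \<in> Sigma {g - 1..N} (\<lambda>n. walks E n u)" by (simp add: x)
    qed
    show "finite (Sigma {g - 1..N} (\<lambda>n. walks E n u))"
      using card_walks_le[OF V deg] by (intro finite_SigmaI) auto
  qed (use t in \<open>auto simp: case_prod_beta\<close>)
  also have "\<dots> = (\<Sum>n = g - 1..N. real (card (walks E n u)) * t ^ n)"
    by (subst sum.Sigma[symmetric]) (use card_walks_le[OF V deg] in auto)
  also have "\<dots> \<le> (\<Sum>n = g - 1..N. L ^ n)"
  proof (rule sum_mono)
    fix n
    have "real (card (walks E n u)) * t ^ n \<le> real (\<Delta> ^ n) * t ^ n"
      using card_walks_le[OF V deg, of n u] t by (intro mult_right_mono of_nat_mono) auto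
    also have "\<dots> = (t * real \<Delta>) ^ n" by (simp add: power_mult_distrib mult.commute)
    also have "\<dots> \<le> L ^ n" by (rule power_mono) (use t in auto)
    finally show "real (card (walks E n u)) * t ^ n \<le> L ^ n" .
  qed
  also have "\<dots> \<le> L ^ (g - 1) / (1 - L)"
    using L L0 by (auto simp: sum_gp divide_right_mono)
  finally show ?thesis .
qed

section \<open>The zero-free disc\<close>

text \<open>By the triangle inequality, deleting one vertex multiplies the norm by at most
  \<open>1 / (1 - a)\<close>. The assumption covers all subgraphs because the deletions are made one
  after another.\<close>

lemma bcf_fun_avoid_ratio:
  assumes step: "\<And>E' w. E' \<subseteq> E \<Longrightarrow>
      norm (bcf_fun V x E' - bcf_fun V x (avoid E' {w})) \<le> a * norm (bcf_fun V x (avoid E' {w}))"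
    and a: "a < 1" and "finite X"
  shows "(1 - a) ^ card X * norm (bcf_fun V x (avoid E X)) \<le> norm (bcf_fun V x E)"
  using \<open>finite X\<close>
proof (induction X rule: finite_induct)
  case empty
  then show ?case by (simp add: avoid_def)
next
  case (insert w X)
  let ?F = "bcf_fun V x"
  have eq: "avoid E (insert w X) = avoid (avoid E X) {w}" by (simp add: avoid_avoid)
  have "norm (?F (avoid (avoid E X) {w})) - norm (?F (avoid E X)) \<le>
      a * norm (?F (avoid (avoid E X) {w}))"
    using step[OF avoid_subset, of X w]
      norm_triangle_ineq2[of "?F (avoid (avoid E X) {w})" "?F (avoid E X)"]
    by (simp add: norm_minus_commute)
  then have "(1 - a) * norm (?F (avoid E (insert w X))) \<le> norm (?F (avoid E X))"
    by (simp add: eq algebra_simps)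
  then have "(1 - a) ^ card X * ((1 - a) * norm (?F (avoid E (insert w X)))) \<le>
      (1 - a) ^ card X * norm (?F (avoid E X))"
    using a by (intro mult_left_mono) auto
  then show ?case using insert by (simp add: mult_ac)
qed

text \<open>Each tree edge contributes \<open>norm x\<close>, and one factor
  \<open>1 / (1 - a)\<close> for a vertex deleted with the tree: this is the edge weight of
  \<open>path_tree_sum\<close>.\<close>

lemma norm_sum_bcf_connected_le:
  assumes V: "simple_graph V E" and inj: "inj_on \<rho> E" and a: "0 \<le> a" "a < 1"
    and ratio: "\<And>X. finite X \<Longrightarrow> (1 - a) ^ card X * norm (bcf_fun V x (avoid (avoid E {u}) X)) \<le>
      norm (bcf_fun V x (avoid E {u}))"
  shows "norm (\<Sum>F | bcf \<rho> E F \<and> conn F u v. x ^ card F) \<le>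
    path_tree_sum (norm x / (1 - a)) E u v * norm (bcf_fun V x (avoid E {u}))"
proof -
  let ?F = "bcf_fun V x" and ?c = "norm x / (1 - a)"
  let ?R = "{T. T \<in> rooted_trees E u \<and> bcf \<rho> E T \<and> conn T u v}"
  note finE = simple_graph_finite[OF V]
  have "norm (\<Sum>F | bcf \<rho> E F \<and> conn F u v. x ^ card F) \<le>
      (\<Sum>T\<in>?R. norm (x ^ card T * ?F (avoid E {z. conn T u z})))"
    unfolding sum_bcf_connected[OF V inj] by (rule norm_sum)
  also have "\<dots> \<le> (\<Sum>T\<in>?R. ?c ^ card T * norm (?F (avoid E {u})))"
  proof (rule sum_mono)
    fix T assume T: "T \<in> ?R"
    let ?C = "{z. conn T u z}"
    have C: "finite ?C" "card ?C \<le> Suc (card T)"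
      using card_rooted_tree_vertices[OF _ finE simple_graph_card[OF V]] T by auto
    \<comment> \<open>The comparison is with the graph in which \<open>u\<close> is already deleted.
      Only the other vertices of the tree cost a factor, so the exponent is \<open>card T\<close>
      and not \<open>Suc (card T)\<close>.\<close>
    have "u \<in> ?C" by simp
    then have "?C = {u} \<union> (?C - {u})" by blast
    then have eq: "avoid E ?C = avoid (avoid E {u}) (?C - {u})"
      by (metis avoid_avoid)
    have "card (?C - {u}) \<le> card T"
      using C \<open>u \<in> ?C\<close> by (simp add: card_Diff_singleton)
    then have "(1 - a) ^ card T \<le> (1 - a) ^ card (?C - {u})"
      using a by (intro power_decreasing) auto
    then have "(1 - a) ^ card T * norm (?F (avoid E ?C)) \<le>
        (1 - a) ^ card (?C - {u}) * norm (?F (avoid E ?C))"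
      by (rule mult_right_mono) simp
    also have "\<dots> \<le> norm (?F (avoid E {u}))"
      using ratio[of "?C - {u}"] C(1) by (simp add: eq)
    finally have "norm x ^ card T * ((1 - a) ^ card T * norm (?F (avoid E ?C))) \<le>
        norm x ^ card T * norm (?F (avoid E {u}))"
      by (rule mult_left_mono) simp
    then show "norm (x ^ card T * ?F (avoid E ?C)) \<le> ?c ^ card T * norm (?F (avoid E {u}))"
      using a by (simp add: norm_mult norm_power power_divide field_simps)
  qed
  also have "\<dots> = (\<Sum>T\<in>?R. ?c ^ card T) * norm (?F (avoid E {u}))"
    by (simp only: sum_distrib_right)
  \<comment> \<open>Dropping the condition \<open>bcf\<close> only adds nonnegative terms.\<close>
  also have "\<dots> \<le> path_tree_sum ?c E u v * norm (?F (avoid E {u}))"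
    unfolding path_tree_sum_def
    by (intro mult_right_mono sum_mono2) (use finite_rooted_trees[OF finE] a in auto)
  finally show ?thesis .
qed

text \<open>The new ordered pairs \<open>(v, w)\<close> and \<open>(w, v)\<close> contribute
  equally. Half of the sum over ordered pairs therefore grows exactly by the terms joining the new
  neighbour to the earlier ones; this is the origin of the factor 1/2 in
  \<open>f_fun\<close>.\<close>

lemma sum_offdiag_insert:
  fixes P :: "'b \<Rightarrow> 'b \<Rightarrow> real"
  assumes "finite W" and "w \<notin> W" and sym: "\<And>v w. P v w = P w v"
  shows "(\<Sum>v\<in>insert w W. \<Sum>z\<in>insert w W - {v}. P v z) =
    (\<Sum>v\<in>W. \<Sum>z\<in>W - {v}. P v z) + 2 * (\<Sum>v\<in>W. P v w)"
proof -
  have "(\<Sum>z\<in>insert w W - {v}. P v z) = P v w + (\<Sum>z\<in>W - {v}. P v z)" if "v \<in> W" for v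
  proof -
    have "insert w W - {v} = insert w (W - {v})" using that assms(2) by auto
    then show ?thesis using assms by simp
  qed
  then have "(\<Sum>v\<in>W. \<Sum>z\<in>insert w W - {v}. P v z) =
      (\<Sum>v\<in>W. P v w) + (\<Sum>v\<in>W. \<Sum>z\<in>W - {v}. P v z)"
    by (simp add: sum.distrib)
  moreover have "insert w W - {w} = W" using assms(2) by auto
  moreover have "(\<Sum>z\<in>W. P w z) = (\<Sum>v\<in>W. P v w)" by (rule sum.cong) (auto simp: sym)
  ultimately show ?thesis using assms by simp
qed

text \<open>Joining \<open>w\<close> multiplies the previous error by \<open>1 + x\<close> and adds
  an error from the forests that already join \<open>u\<close> to \<open>w\<close>. At that moment
  \<open>u\<close> has only the neighbours in \<open>W\<close>, so the path to \<open>w\<close>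
  starts at an earlier neighbour.\<close>

lemma bcf_fun_star_le:
  fixes a b :: real and x :: complex
  defines "t \<equiv> norm x / (1 - a) * b"
  assumes V: "simple_graph V E" and deg: "\<And>z. card (nbrs E z) \<le> \<Delta>"
    and a: "0 \<le> a" "a < 1" and b: "1 \<le> b" "(1 + t) ^ \<Delta> \<le> b"
    and ratio: "\<And>X. finite X \<Longrightarrow> (1 - a) ^ card X * norm (bcf_fun V x (avoid (avoid E {u}) X)) \<le>
      norm (bcf_fun V x (avoid E {u}))"
    and W: "finite W" "W \<subseteq> nbrs E u"
  shows "norm (bcf_fun V x (avoid E {u} \<union> (\<lambda>w. {u, w}) ` W) -
      (1 + x) ^ card W * bcf_fun V x (avoid E {u}))
    \<le> (1 + t) ^ card W *
      (t * (\<Sum>v\<in>W. \<Sum>w\<in>W - {v}. path_sum t (avoid E {u}) v w) / 2) * norm (bcf_fun V x (avoid E {u}))"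
  using W
proof (induction W rule: finite_induct)
  case (insert w W)
  let ?F = "bcf_fun V x" and ?c = "norm x / (1 - a)"
  define E' where "E' = avoid E {u} \<union> (\<lambda>w. {u, w}) ` W"
  define S where "S = (\<Sum>v\<in>W. \<Sum>w\<in>W - {v}. path_sum t (avoid E {u}) v w)"
  define M where "M = norm (?F (avoid E {u}))"
  have w: "w \<in> nbrs E u" and W: "W \<subseteq> nbrs E u" using insert by auto
  have c: "0 \<le> ?c" using a by simp
  have t: "0 \<le> t" unfolding t_def using b by (intro mult_nonneg_nonneg c) simp
  have E'E: "E' \<subseteq> E" using W by (auto simp: E'_def avoid_def nbrs_def)
  have V': "simple_graph V E'" by (rule simple_graph_subset[OF V E'E])
  have uw: "{u, w} \<notin> E'" "u \<noteq> w"
    using insert(2) nbrs_irrefl[OF V] w by (auto simp: E'_def avoid_def doubleton_eq_iff)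
  have V'': "simple_graph V (insert {u, w} E')"
    by (rule simple_graph_subset[OF V]) (use E'E w in \<open>auto simp: nbrs_def\<close>)
  have uW: "u \<notin> W" using nbrs_irrefl[OF V] W by auto
  have nbrs: "nbrs E' u = W"
    using uW by (auto simp: E'_def nbrs_def avoid_def doubleton_eq_iff)
  have av: "avoid E' {u} = avoid E {u}" by (auto simp: E'_def avoid_def)
  have finE': "finite E'" by (rule simple_graph_finite[OF V'])
  obtain \<rho>0 :: "'a set \<Rightarrow> nat" and n where \<rho>0: "\<rho>0 ` E' = {i. i < n}" "inj_on \<rho>0 E'"
    using finite_imp_inj_to_nat_seg[OF finE'] by blast
  \<comment> \<open>The labels of \<open>E'\<close> are the numbers below \<open>n\<close>, so the
    label \<open>n\<close> makes the new edge the largest.\<close>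
  define \<rho> where "\<rho> = \<rho>0({u, w} := n)"
  have \<rho>_less: "\<rho> f < \<rho> {u, w}" if "f \<in> E'" for f
    using that \<rho>0(1) uw(1) by (auto simp: \<rho>_def)
  have inj': "inj_on \<rho> E'"
    using \<rho>0(2) uw(1) unfolding inj_on_def \<rho>_def by auto
  have inj: "inj_on \<rho> (insert {u, w} E')"
  proof -
    have "\<rho> {u, w} \<noteq> \<rho> f" if "f \<in> E'" for f using \<rho>_less[OF that] by simp
    then have "\<rho> {u, w} \<notin> \<rho> ` E'" by blast
    then show ?thesis using inj' uw(1) by (simp add: inj_on_insert)
  qed
  define Q where "Q = (\<Sum>F | bcf \<rho> E' F \<and> conn F u w. x ^ card F)"
  have "insert {u, w} E' - {{u, w}} = E'" using uw(1) by auto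
  then have F: "?F (insert {u, w} E') = (1 + x) * (?F E' - Q)"
    using bcf_fun_max_edge[OF V'' _ inj, of u w x] \<rho>_less by (auto simp: Q_def)
  have "norm Q \<le> path_tree_sum ?c E' u w * M"
    unfolding Q_def M_def av[symmetric]
    by (rule norm_sum_bcf_connected_le[OF V' inj' a]) (simp add: av ratio)
  also have "path_tree_sum ?c E' u w \<le> (1 + ?c * b) ^ card (nbrs E' u) * path_sum (?c * b) E' u w"
  proof (rule path_tree_sum_le[OF V'])
    show "card (nbrs E' z) \<le> \<Delta>" for z
      using le_trans[OF card_nbrs_mono[OF V E'E] deg] .
  qed (use b c in \<open>auto simp: t_def\<close>)
  also have "path_sum (?c * b) E' u w = t * (\<Sum>v\<in>W. path_sum t (avoid E {u}) v w)"
    by (simp add: path_sum_Cons[OF V' uw(2)] nbrs av t_def sum_distrib_left)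
  finally have Q: "norm Q \<le> (1 + t) ^ card W * (t * (\<Sum>v\<in>W. path_sum t (avoid E {u}) v w)) * M"
    by (simp add: nbrs t_def M_def mult_right_mono)
  have IH: "norm (?F E' - (1 + x) ^ card W * ?F (avoid E {u})) \<le> (1 + t) ^ card W * (t * S / 2) * M"
    using insert.IH[OF W] by (simp add: E'_def S_def M_def)
  \<comment> \<open>Here \<open>1 - a \<le> 1 \<le> b\<close> gives \<open>norm x \<le> t\<close>,
    so the reinserted edge fits into the same power of \<open>1 + t\<close>.\<close>
  have x1: "norm (1 + x) \<le> 1 + t"
  proof -
    have "norm x * (1 - a) \<le> norm x * b"
      using a b by (intro mult_left_mono) auto
    then have "norm x \<le> t" using a by (simp add: t_def field_simps)
    then show ?thesis using norm_triangle_ineq[of 1 x] by simp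
  qed
  have "?F (insert {u, w} E') - (1 + x) ^ card (insert w W) * ?F (avoid E {u}) =
      (1 + x) * ((?F E' - (1 + x) ^ card W * ?F (avoid E {u})) - Q)"
    using insert(1,2) by (simp add: F algebra_simps)
  then have "norm (?F (insert {u, w} E') - (1 + x) ^ card (insert w W) * ?F (avoid E {u})) \<le>
      norm (1 + x) * (norm (?F E' - (1 + x) ^ card W * ?F (avoid E {u})) + norm Q)"
    using norm_triangle_ineq4[of "?F E' - (1 + x) ^ card W * ?F (avoid E {u})" Q]
    by (simp add: norm_mult mult_left_mono)
  also have "\<dots> \<le> (1 + t) * ((1 + t) ^ card W * (t * S / 2) * M +
      (1 + t) ^ card W * (t * (\<Sum>v\<in>W. path_sum t (avoid E {u}) v w)) * M)"
    by (intro mult_mono add_mono x1 IH Q) (use t in auto)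
  also have "\<dots> = (1 + t) ^ card (insert w W) *
      (t * (S + 2 * (\<Sum>v\<in>W. path_sum t (avoid E {u}) v w)) / 2) * M"
    using insert(1,2) by (simp add: algebra_simps)
  also have "S + 2 * (\<Sum>v\<in>W. path_sum t (avoid E {u}) v w) =
      (\<Sum>v\<in>insert w W. \<Sum>z\<in>insert w W - {v}. path_sum t (avoid E {u}) v z)"
    unfolding S_def by (rule sum_offdiag_insert[OF insert(1,2) path_sum_sym, symmetric])
  finally show ?case by (simp add: E'_def M_def)
qed simp

text \<open>The expansion of \<open>(1 + x) ^ n - 1\<close> has nonnegative coefficients.\<close>

lemma norm_one_plus_power_minus_one_le:
  fixes x :: complex
  shows "norm ((1 + x) ^ n - 1) \<le> (1 + norm x) ^ n - 1"
proof (induction n)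
  case (Suc n)
  have "norm ((1 + x) ^ Suc n - 1) = norm ((1 + x) * ((1 + x) ^ n - 1) + x)"
    by (simp add: algebra_simps)
  also have "\<dots> \<le> norm (1 + x) * norm ((1 + x) ^ n - 1) + norm x"
    by (rule order_trans[OF norm_triangle_ineq]) (simp add: norm_mult)
  also have "\<dots> \<le> (1 + norm x) * ((1 + norm x) ^ n - 1) + norm x"
    using norm_triangle_ineq[of 1 x] Suc by (intro add_right_mono mult_mono) auto
  finally show ?case by (simp add: algebra_simps)
qed simp

lemma one_plus_power_le_exp:
  fixes s :: real
  assumes "0 \<le> s"
  shows "(1 + s) ^ n \<le> exp (real n * s)"
proof -
  have "(1 + s) ^ n \<le> exp s ^ n" by (rule power_mono) (use assms exp_ge_add_one_self in auto)
  then show ?thesis by (simp add: exp_of_nat_mult)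
qed

text \<open>The two claims support each other: the estimate for \<open>E\<close> rests on the
  estimates for its proper subgraphs, and nonvanishing follows from the estimate at an end of some
  edge, because \<open>a < 1\<close> and the graph without that vertex has a nonzero value.\<close>

lemma bcf_fun_zero_free:
  fixes x :: complex and a b :: real
  assumes V: "simple_graph V E" and deg: "\<And>z. card (nbrs E z) \<le> \<Delta>"
    and girth: "\<And>vs. is_cycle E vs \<Longrightarrow> g \<le> length vs"
    and a: "0 \<le> a" "a < 1" and b: "1 \<le> b" "b < exp 1" and f: "f_fun g a b \<le> a"
    and x: "norm x * real \<Delta> \<le> h_fun a b"
  shows "bcf_fun V x E \<noteq> 0 \<and> (\<forall>u. norm (bcf_fun V x E - bcf_fun V x (avoid E {u})) \<le>
    a * norm (bcf_fun V x (avoid E {u})))"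
  using V deg girth
proof (induction "card E" arbitrary: E rule: less_induct)
  case less
  let ?F = "bcf_fun V x"
  define L t where "L = ln b" and "t = norm x / (1 - a) * b"
  note V = less.prems(1) and deg = less.prems(2) and girth = less.prems(3)
  note finE = simple_graph_finite[OF V]
  have L: "0 \<le> L" "L < 1"
    using b ln_less_cancel_iff[of b "exp 1"] by (auto simp: L_def)
  have t: "0 \<le> t" using a b by (simp add: t_def)
  have tL: "t * real \<Delta> \<le> L"
  proof -
    have "b * (norm x * real \<Delta>) \<le> b * h_fun a b" by (rule mult_left_mono[OF x]) (use b in simp)
    also have "\<dots> = (1 - a) * L" using b by (simp add: h_fun_def L_def)
    finally show ?thesis using a by (simp add: t_def field_simps)
  qed
  have tb: "(1 + t) ^ \<Delta> \<le> b"
  proof -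
    have "(1 + t) ^ \<Delta> \<le> exp (real \<Delta> * t)" by (rule one_plus_power_le_exp[OF t])
    also have "\<dots> \<le> exp L" using tL by (simp add: mult.commute)
    finally show ?thesis using b by (simp add: L_def)
  qed
  have IH: "?F E' \<noteq> 0 \<and> (\<forall>u. norm (?F E' - ?F (avoid E' {u})) \<le> a * norm (?F (avoid E' {u})))"
    if "E' \<subset> E" for E'
  proof (rule less.hyps)
    have sub: "E' \<subseteq> E" using that by (rule psubset_imp_subset)
    show "card E' < card E" by (rule psubset_card_mono[OF finE that])
    show "simple_graph V E'" by (rule simple_graph_subset[OF V sub])
    show "card (nbrs E' z) \<le> \<Delta>" for z by (rule le_trans[OF card_nbrs_mono[OF V sub] deg])
    show "g \<le> length vs" if "is_cycle E' vs" for vs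
      by (rule girth) (use that sub in \<open>auto simp: is_cycle_def\<close>)
  qed
  \<comment> \<open>A vertex with a neighbour makes \<open>avoid E {u}\<close> a proper subset of
    \<open>E\<close>, to which the induction hypothesis applies. For an isolated \<open>u\<close>
    the two graphs coincide and the estimate is trivial.\<close>
  have step: "norm (?F E - ?F (avoid E {u})) \<le> a * norm (?F (avoid E {u}))"
    if ne: "nbrs E u \<noteq> {}" for u
  proof -
    let ?N = "nbrs E u" and ?M = "norm (?F (avoid E {u}))"
    define S where "S = (\<Sum>v\<in>?N. \<Sum>w\<in>?N - {v}. path_sum t (avoid E {u}) v w)"
    obtain w where "{u, w} \<in> E" "{u, w} \<notin> avoid E {u}"
      using ne by (auto simp: avoid_def nbrs_def)
    then have sub: "avoid E {u} \<subset> E" using avoid_subset[of E "{u}"] by blast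
    have ratio: "(1 - a) ^ card X * norm (?F (avoid (avoid E {u}) X)) \<le> ?M" if "finite X" for X
    proof (rule bcf_fun_avoid_ratio[OF _ a(2) that])
      fix E' w assume "E' \<subseteq> avoid E {u}"
      then have "E' \<subset> E" using sub by (rule subset_psubset_trans)
      then show "norm (?F E' - ?F (avoid E' {w})) \<le> a * norm (?F (avoid E' {w}))"
        using IH by blast
    qed
    have "avoid E {u} \<union> (\<lambda>w. {u, w}) ` ?N = E"
    proof (intro equalityI subsetI)
      fix e assume e: "e \<in> E"
      show "e \<in> avoid E {u} \<union> (\<lambda>w. {u, w}) ` ?N"
      proof (cases "u \<in> e")
        case True
        then obtain w where "e = {u, w}" using simple_graph_card[OF V e] by (auto simp: card_2_iff)
        then show ?thesis using e by (auto simp: nbrs_def)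
      qed (use e in \<open>simp add: avoid_def\<close>)
    qed (auto simp: avoid_def nbrs_def)
    then have star: "norm (?F E - (1 + x) ^ card ?N * ?F (avoid E {u})) \<le>
        (1 + t) ^ card ?N * (t * S / 2) * ?M"
      using bcf_fun_star_le[OF V deg a b(1) tb[unfolded t_def] ratio finite_nbrs[OF V] subset_refl]
      by (simp only: t_def S_def)
    have tS: "t * S \<le> L ^ (g - 1) / (1 - L)"
      unfolding S_def by (rule sum_path_sum_le[OF V deg girth t tL L(2)])
    have tS0: "0 \<le> t * S"
      unfolding S_def using t by (intro mult_nonneg_nonneg sum_nonneg path_sum_nonneg)
    have "(1 + t) ^ card ?N \<le> (1 + t) ^ \<Delta>"
      using t deg[of u] by (intro power_increasing) auto
    then have "(1 + t) ^ card ?N \<le> b" using tb by simp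
    then have "(1 + t) ^ card ?N * (t * S / 2) \<le> b * ((L ^ (g - 1) / (1 - L)) / 2)"
      using b by (intro mult_mono divide_right_mono tS divide_nonneg_nonneg tS0) auto
    then have 1: "(1 + t) ^ card ?N * (t * S / 2) \<le> b * L ^ (g - 1) / (2 * (1 - L))"
      by (simp only: divide_divide_eq_left times_divide_eq_right mult.commute[of 2])
    have "norm ((1 + x) ^ card ?N - 1) \<le> (1 + norm x) ^ card ?N - 1"
      by (rule norm_one_plus_power_minus_one_le)
    also have "\<dots> \<le> exp (real (card ?N) * norm x) - 1"
      using one_plus_power_le_exp[of "norm x" "card ?N"] by simp
    also have "\<dots> \<le> exp (h_fun a b) - 1"
    proof -
      have "real (card ?N) * norm x \<le> norm x * real \<Delta>"
        using mult_left_mono[of "real (card ?N)" "real \<Delta>" "norm x"] deg[of u]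
        by (simp add: mult.commute)
      then show ?thesis using x by simp
    qed
    finally have 2: "norm ((1 + x) ^ card ?N - 1) \<le> exp (h_fun a b) - 1" .
    \<comment> \<open>The first summand is the error from closing cycles, the second the effect of a
      star without cycles; their bounds are the two parts of \<open>f_fun g a b\<close>.\<close>
    have "?F E - ?F (avoid E {u}) = (?F E - (1 + x) ^ card ?N * ?F (avoid E {u})) +
        ((1 + x) ^ card ?N - 1) * ?F (avoid E {u})"
      by (simp add: algebra_simps)
    then have "norm (?F E - ?F (avoid E {u})) \<le>
        norm (?F E - (1 + x) ^ card ?N * ?F (avoid E {u})) + norm ((1 + x) ^ card ?N - 1) * ?M"
      by (metis norm_mult norm_triangle_ineq)
    also have "\<dots> \<le> (1 + t) ^ card ?N * (t * S / 2) * ?M + norm ((1 + x) ^ card ?N - 1) * ?M"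
      using star by simp
    also have "\<dots> \<le> b * L ^ (g - 1) / (2 * (1 - L)) * ?M + (exp (h_fun a b) - 1) * ?M"
      by (intro add_mono mult_right_mono 1 2) auto
    also have "\<dots> = f_fun g a b * ?M"
      by (simp add: f_fun_def h_fun_def L_def algebra_simps)
    also have "\<dots> \<le> a * ?M" using f by (rule mult_right_mono) simp
    finally show ?thesis .
  qed
  have nz: "?F E \<noteq> 0"
  proof (cases "E = {}")
    case True
    have "num_components V {} + card ({} :: 'a set set) = card V"
      by (rule num_components_bcf[of "\<lambda>_. 0" "{}"])
        (use V in \<open>auto simp: bcf_def simple_graph_def\<close>)
    then show ?thesis using True by (simp add: bcf_fun_def)
  next
    case False
    then obtain e where e: "e \<in> E" by blast
    then obtain u w where uw: "e = {u, w}" using simple_graph_card[OF V e] by (auto simp: card_2_iff)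
    then have "e \<notin> avoid E {u}" by (simp add: avoid_def)
    then have "avoid E {u} \<subset> E" using e avoid_subset[of E "{u}"] by blast
    then have M: "?F (avoid E {u}) \<noteq> 0" using IH by blast
    have "nbrs E u \<noteq> {}" using e uw by (auto simp: nbrs_def)
    then have s: "norm (?F E - ?F (avoid E {u})) \<le> a * norm (?F (avoid E {u}))" by (rule step)
    show ?thesis
    proof
      assume "?F E = 0"
      then have "(1 - a) * norm (?F (avoid E {u})) \<le> 0" using s by (simp add: algebra_simps)
      then show False using a M by (simp add: mult_le_0_iff)
    qed
  qed
  have "norm (?F E - ?F (avoid E {u})) \<le> a * norm (?F (avoid E {u}))" for u
  proof (cases "nbrs E u = {}")
    case True
    have "u \<notin> e" if e: "e \<in> E" for e
    proof
      assume "u \<in> e"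
      then obtain w where "e = {u, w}" using simple_graph_card[OF V e] by (auto simp: card_2_iff)
      then show False using True e by (auto simp: nbrs_def)
    qed
    then have "avoid E {u} = E" by (auto simp: avoid_def)
    then show ?thesis using a by simp
  qed (rule step)
  with nz show ?case by blast
qed

section \<open>Broken circuits as cycles\<close>

text \<open>Loop erasure: if the new first vertex already lies on the path, the path is cut there
  instead of being extended.\<close>

lemma conn_imp_path:
  assumes "conn A u v"
  obtains p where "p \<in> paths A u v"
proof -
  have "\<exists>p. p \<in> paths A u v"
    using assms
  proof (induction rule: conn_converse_induct)
    case refl
    have "[v] \<in> paths A v v" by (simp add: paths_def)
    then show ?case by blast
  next
    case (step y z)
    then obtain p where p: "p \<in> paths A z v" by blast
    show ?case
    proof (cases "y \<in> set p")
      case True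
      then obtain q r where "p = q @ y # r" by (meson split_list)
      then have "y # r \<in> paths A y v"
        using p by (auto simp: paths_def successively_append_iff)
      then show ?thesis by blast
    next
      case False
      then have "y # p \<in> paths A y v"
        using p step(1) by (auto simp: paths_def successively_Cons)
      then show ?thesis by blast
    qed
  qed
  then show thesis using that by blast
qed

lemma add_mod_neq:
  assumes "(i :: nat) < n" and "0 < m" and "m < n"
  shows "(i + m) mod n \<noteq> i"
proof (cases "i + m < n")
  case False
  then have "(i + m) mod n = i + m - n" using assms by (simp add: mod_if)
  then show ?thesis using assms False by simp
qed (use assms in simp)

text \<open>Go round the cycle the long way. A step \<open>?p\<close>, \<open>?q\<close> equal to
  the removed edge would start at \<open>i\<close>, or lead from \<open>j\<close> to
  \<open>i\<close>; the latter means that two steps from \<open>i\<close> return to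
  \<open>i\<close>, which is impossible for length at least 3.\<close>

lemma cycle_minus_edge_conn:
  assumes "distinct vs" and n: "3 \<le> length vs" and i: "i < length vs"
  defines "j \<equiv> Suc i mod length vs"
  shows "vs ! i \<noteq> vs ! j" and "conn (cycle_edges vs - {{vs ! i, vs ! j}}) (vs ! j) (vs ! i)"
proof -
  let ?n = "length vs" and ?B = "cycle_edges vs - {{vs ! i, vs ! j}}"
  have n0: "0 < ?n" using n by linarith
  then have j: "j < ?n" unfolding j_def by (rule mod_less_divisor)
  have "j \<noteq> i" using add_mod_neq[OF i, of 1] n by (simp add: j_def)
  then show "vs ! i \<noteq> vs ! j" using assms(1) i j by (simp add: nth_eq_iff_index_eq)
  have "conn ?B (vs ! j) (vs ! ((i + Suc k) mod ?n))" if "k < ?n" for k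
    using that
  proof (induction k)
    case 0
    then show ?case by (simp add: j_def)
  next
    case (Suc k)
    let ?p = "(i + Suc k) mod ?n" and ?q = "(i + Suc (Suc k)) mod ?n"
    have pq: "?p < ?n" "?q < ?n" "?q = Suc ?p mod ?n"
      using n0 by (simp_all add: mod_Suc_eq)
    have "?p \<noteq> i" using add_mod_neq[OF i, of "Suc k"] Suc.prems by simp
    moreover have "\<not> (?p = j \<and> ?q = i)"
    proof
      assume "?p = j \<and> ?q = i"
      then have "Suc j mod ?n = i" using pq(3) by simp
      then have "(i + 2) mod ?n = i" by (simp add: j_def mod_Suc_eq)
      then show False using add_mod_neq[OF i, of 2] n by simp
    qed
    ultimately have "{vs ! ?p, vs ! ?q} \<noteq> {vs ! i, vs ! j}"
      using assms(1) i j pq(1,2) by (auto simp: doubleton_eq_iff nth_eq_iff_index_eq)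
    moreover have "{vs ! ?p, vs ! ?q} \<in> cycle_edges vs"
      using pq by (auto simp: cycle_edges_def)
    ultimately have "{vs ! ?p, vs ! ?q} \<in> ?B" by simp
    then have "conn ?B (vs ! ?p) (vs ! ?q)" by (rule conn_edge)
    then show ?case using conn_trans[OF Suc.IH] Suc.prems by simp
  qed
  from this[of "?n - 1"] show "conn ?B (vs ! j) (vs ! i)" using n0 i by simp
qed

text \<open>The label of an edge is its rank in \<open>r\<close>. A cycle minus its largest edge
  joins the ends of that edge by smaller ones; conversely, a path of smaller edges closes up to a
  cycle in which the joining edge is the largest.\<close>

lemma BCF_iff_bcf:
  assumes V: "simple_graph V E" and r: "linear_order_on E r"
  defines "\<rho> \<equiv> \<lambda>e. card {e' \<in> E. (e', e) \<in> r}"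
  shows "inj_on \<rho> E" and "BCF r E F \<longleftrightarrow> bcf \<rho> E F"
proof -
  note finE = simple_graph_finite[OF V]
  have refl: "(e, e) \<in> r" if "e \<in> E" for e
    using r that by (auto simp: order_on_defs refl_on_def)
  have tr: "trans r" and anti: "antisym r" and tot: "total_on E r"
    using r by (auto simp: order_on_defs)
  have mono: "\<rho> e' < \<rho> e" if e: "(e', e) \<in> r" "e' \<noteq> e" "e \<in> E" for e e'
  proof -
    have "{f \<in> E. (f, e') \<in> r} \<subseteq> {f \<in> E. (f, e) \<in> r}"
      using e(1) tr by (auto dest: transD)
    moreover have "(e, e') \<notin> r" using anti e by (auto dest: antisymD)
    ultimately have "{f \<in> E. (f, e') \<in> r} \<subset> {f \<in> E. (f, e) \<in> r}"
      using refl[OF e(3)] e(3) by blast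
    then show ?thesis unfolding \<rho>_def using finE by (intro psubset_card_mono) auto
  qed
  have less_iff: "\<rho> e' < \<rho> e \<longleftrightarrow> (e', e) \<in> r \<and> e' \<noteq> e" if "e \<in> E" "e' \<in> E" for e e'
  proof
    assume less: "\<rho> e' < \<rho> e"
    then have ne: "e' \<noteq> e" by auto
    moreover have "(e, e') \<notin> r" using mono[of e e'] ne that less by auto
    ultimately show "(e', e) \<in> r \<and> e' \<noteq> e" using tot that unfolding total_on_def by blast
  qed (use mono that in blast)
  show "inj_on \<rho> E"
  proof (rule inj_onI, rule ccontr)
    fix e e' assume e: "e \<in> E" "e' \<in> E" "\<rho> e = \<rho> e'" "e \<noteq> e'"
    then have "(e, e') \<in> r \<or> (e', e) \<in> r" using tot unfolding total_on_def by blast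
    then show False using mono[of e e'] mono[of e' e] e by auto
  qed
  have "(\<exists>B. broken_circuit r E B \<and> B \<subseteq> F) \<longleftrightarrow>
      (\<exists>p q. {p, q} \<in> E \<and> p \<noteq> q \<and> conn {f \<in> F. \<rho> f < \<rho> {p, q}} p q)" if F: "F \<subseteq> E"
  proof
    assume "\<exists>B. broken_circuit r E B \<and> B \<subseteq> F"
    then obtain B where B: "broken_circuit r E B" and BF: "B \<subseteq> F" by (elim exE conjE)
    obtain vs e where cyc: "is_cycle E vs" and e: "e \<in> cycle_edges vs"
      and max: "\<forall>e'\<in>cycle_edges vs. (e', e) \<in> r" and B_eq: "B = cycle_edges vs - {e}"
      using B unfolding broken_circuit_def by (elim exE conjE)
    have sub: "cycle_edges vs - {e} \<subseteq> F" using BF by (simp only: B_eq)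
    obtain i where i: "i < length vs" "e = {vs ! i, vs ! (Suc i mod length vs)}"
      using e by (auto simp: cycle_edges_def)
    let ?p = "vs ! (Suc i mod length vs)" and ?q = "vs ! i"
    have vs: "distinct vs" "3 \<le> length vs" "cycle_edges vs \<subseteq> E"
      using cyc by (auto simp: is_cycle_def)
    have pq: "e = {?p, ?q}" using i(2) by auto
    note c = cycle_minus_edge_conn[OF vs(1,2) i(1)]
    have eE: "e \<in> E" using e vs(3) by blast
    have "cycle_edges vs - {e} \<subseteq> {f \<in> F. \<rho> f < \<rho> e}"
    proof
      fix f assume f: "f \<in> cycle_edges vs - {e}"
      then have "\<rho> f < \<rho> e" using mono[of f e] max eE by blast
      then show "f \<in> {f \<in> F. \<rho> f < \<rho> e}" using f sub by blast
    qed
    then have "conn {f \<in> F. \<rho> f < \<rho> e} ?p ?q"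
      using conn_mono[OF c(2)] i(2) by simp
    then have "{?p, ?q} \<in> E \<and> ?p \<noteq> ?q \<and> conn {f \<in> F. \<rho> f < \<rho> {?p, ?q}} ?p ?q"
      using eE not_sym[OF c(1)] by (simp only: pq) simp
    then show "\<exists>p q. {p, q} \<in> E \<and> p \<noteq> q \<and> conn {f \<in> F. \<rho> f < \<rho> {p, q}} p q"
      by (intro exI)
  next
    assume "\<exists>p q. {p, q} \<in> E \<and> p \<noteq> q \<and> conn {f \<in> F. \<rho> f < \<rho> {p, q}} p q"
    then obtain p q where pq: "{p, q} \<in> E" "p \<noteq> q" "conn {f \<in> F. \<rho> f < \<rho> {p, q}} p q" by blast
    let ?e = "{p, q}"
    let ?A = "{f \<in> F. \<rho> f < \<rho> ?e}"
    obtain vs where vs: "vs \<in> paths ?A p q" using pq(3) by (rule conn_imp_path)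
    \<comment> \<open>A path on two vertices would be the edge \<open>{p, q}\<close> itself, which
      is not below itself.\<close>
    have len: "3 \<le> length vs"
    proof (rule ccontr)
      assume "\<not> 3 \<le> length vs"
      moreover have "vs \<noteq> []" "hd vs \<noteq> last vs" using vs pq(2) by (auto simp: paths_def)
      ultimately obtain y z where "vs = [y, z]"
        by (cases vs rule: remdups_adj.cases) (auto simp: Suc_le_eq numeral_eq_Suc)
      then show False using vs by (auto simp: paths_def)
    qed
    have edges: "cycle_edges vs \<subseteq> insert ?e ?A"
    proof (rule cycle_edges_subset)
      show "successively (\<lambda>x y. {x, y} \<in> insert ?e ?A) vs"
        using vs by (auto simp: paths_def elim: successively_mono)
    qed (use vs in \<open>auto simp: paths_def insert_commute\<close>)
    have "?e \<in> cycle_edges vs"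
    proof -
      have "vs \<noteq> []" "hd vs = p" "last vs = q" using vs by (auto simp: paths_def)
      then have "vs ! (length vs - 1) = q" "vs ! (Suc (length vs - 1) mod length vs) = p"
        by (simp_all add: last_conv_nth hd_conv_nth)
      moreover have "length vs - 1 < length vs" using len by simp
      ultimately have "\<exists>i<length vs. {q, p} = {vs ! i, vs ! (Suc i mod length vs)}"
        by (intro exI[of _ "length vs - 1"]) simp
      then show ?thesis unfolding cycle_edges_def insert_commute[of p q] by blast
    qed
    moreover have "is_cycle E vs"
      using len vs edges F pq(1) by (auto simp: is_cycle_def paths_def)
    moreover have "(f, ?e) \<in> r" if "f \<in> cycle_edges vs" for f
    proof (cases "f = ?e")
      case False
      then have "f \<in> F" "\<rho> f < \<rho> ?e" using edges that by auto
      then show ?thesis using less_iff[OF pq(1), of f] F by auto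
    qed (use refl[OF pq(1)] in simp)
    ultimately have "broken_circuit r E (cycle_edges vs - {?e})"
      unfolding broken_circuit_def by blast
    moreover have "cycle_edges vs - {?e} \<subseteq> F" using edges by blast
    ultimately show "\<exists>B. broken_circuit r E B \<and> B \<subseteq> F" by (intro exI conjI)
  qed
  moreover have "(\<nexists>p q. {p, q} \<in> E \<and> p \<noteq> q \<and> conn {f \<in> F. \<rho> f < \<rho> {p, q}} p q) \<longleftrightarrow>
      (\<forall>p q. {p, q} \<in> E \<longrightarrow> p \<noteq> q \<longrightarrow> \<not> conn {f \<in> F. \<rho> f < \<rho> {p, q}} p q)"
    by (simp only: not_ex de_Morgan_conj imp_conv_disj)
  ultimately show "BCF r E F \<longleftrightarrow> bcf \<rho> E F"
    unfolding BCF_def bcf_def by (cases "F \<subseteq> E") simp_all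
qed

section \<open>Transfer to the stated polynomials and the maximum degree\<close>

lemma poly_BCF_poly:
  assumes "simple_graph V E" and "linear_order_on E r"
  shows "poly (BCF_poly r E) x = bcf_fun V x E"
  by (simp add: BCF_poly_def poly_sum poly_monom BCF_iff_bcf(2)[OF assms]
      bcf_fun_eq_sum_bcf[OF assms(1) BCF_iff_bcf(1)[OF assms]])

lemma card_nbrs_le_max_degree:
  assumes V: "simple_graph V E"
  shows "card (nbrs E u) \<le> max_degree V E"
proof (cases "u \<in> V")
  case True
  have "card (nbrs E u) \<le> degree_of E u"
    unfolding degree_of_def
  proof (rule card_inj_on_le[where f = "\<lambda>w. {u, w}"])
    show "inj_on (\<lambda>w. {u, w}) (nbrs E u)" by (rule inj_onI) (auto simp: doubleton_eq_iff)
  qed (use simple_graph_finite[OF V] in \<open>auto simp: nbrs_def\<close>)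
  also have "\<dots> \<le> max_degree V E"
    unfolding max_degree_def
    by (rule cSUP_upper[OF True]) (use V in \<open>simp add: simple_graph_def\<close>)
  finally show ?thesis .
next
  case False
  then have "nbrs E u = {}" using V by (auto simp: nbrs_def simple_graph_def)
  then show ?thesis by simp
qed

theorem theorem3p1:
  fixes g \<Delta> :: nat and a b :: real
    and V :: "'a set" and E :: "'a set set" and r :: "'a set rel"
  assumes "g \<ge> 3"
    and "a \<in> {0..<1}" and "b \<in> {1..<exp 1}"
    and "f_fun g a b \<le> a"
    and "simple_graph V E" and "linear_order_on E r"
    and "girth E \<ge> enat g"
    and "\<Delta> \<ge> 1" and "max_degree V E \<le> \<Delta>"
  shows "(\<forall>x::complex. norm x \<le> h_fun a b / real \<Delta> \<longrightarrow> poly (BCF_poly r E) x \<noteq> 0) \<and>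
         (\<forall>x::complex. h_fun a b > 0 \<longrightarrow> norm x \<ge> real \<Delta> / h_fun a b \<longrightarrow>
            poly (chromatic_poly V E) x \<noteq> 0)"
proof -
  have \<Delta>: "0 < real \<Delta>" using assms(8) by simp
  have girth: "g \<le> length vs" if "is_cycle E vs" for vs
  proof -
    have "girth E \<le> enat (length vs)"
      unfolding girth_def by (rule INF_lower) (use that in simp)
    then have "enat g \<le> enat (length vs)" using assms(7) by (rule order_trans[rotated])
    then show ?thesis by simp
  qed
  have zero_free: "bcf_fun V x E \<noteq> 0" if "norm x \<le> h_fun a b / real \<Delta>" for x
  proof -
    have "norm x * real \<Delta> \<le> h_fun a b" using that \<Delta> by (simp add: field_simps)
    then show ?thesis
      using bcf_fun_zero_free[OF assms(5) le_trans[OF card_nbrs_le_max_degree[OF assms(5)] assms(9)] girth]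
        assms(2-4) by auto
  qed
  show ?thesis
  proof (intro conjI allI impI)
    fix x :: complex assume "norm x \<le> h_fun a b / real \<Delta>"
    then show "poly (BCF_poly r E) x \<noteq> 0"
      using zero_free poly_BCF_poly[OF assms(5,6)] by simp
  next
    fix x :: complex assume h: "0 < h_fun a b" and x: "real \<Delta> / h_fun a b \<le> norm x"
    have "0 < real \<Delta> / h_fun a b" using h \<Delta> by simp
    then have nx: "0 < norm x" using x by (rule less_le_trans)
    then have "x \<noteq> 0" by simp
    have "real \<Delta> \<le> norm x * h_fun a b" using x h by (simp add: field_simps)
    \<comment> \<open>Up to the power \<open>x ^ card V\<close>, the chromatic polynomial at
      \<open>x\<close> is the other polynomial at \<open>- inverse x\<close>, and this map carries
      the outer region into the zero-free disc.\<close>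
    then have "norm (- inverse x) \<le> h_fun a b / real \<Delta>"
      using \<Delta> nx by (simp only: norm_minus_cancel norm_inverse) (simp add: field_simps)
    then have "bcf_fun V (- inverse x) E \<noteq> 0" by (rule zero_free)
    then show "poly (chromatic_poly V E) x \<noteq> 0"
      using chromatic_poly_eq_bcf_fun[OF assms(5) \<open>x \<noteq> 0\<close>] \<open>x \<noteq> 0\<close> by simp
  qed
qed

end
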